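(* For any $n\times n$ Hermitian matrices $A$, $B$ and $C$, $$\iota(\mathcal{G}_A,\mathcal{G}_B,\mathcal{G}_C) = n_-(B-A) - n_-(C-A) + n_-(C-B).$$
   Context: $\mathbb{C}^n\oplus\mathbb{C}^n$ is equipped with the canonical (sesquilinear) Hermitian symplectic form $\omega((x_1,x_2),(y_1,y_2)) := \langle x_1,y_2\rangle_{\mathbb{C}^n} - \langle x_2,y_1\rangle_{\mathbb{C}^n}$. A subspace $\mathcal{L}$ is Lagrangian if it equals $\{v : \omega(u,v)=0 \text{ for all } u\in\mathcal{L}\}$; $\Lambda(n)$ is the set of Lagrangian planes. For an $n\times n$ Hermitian matrix $M$, $\mathcal{G}_M := \{(x,Mx): x\in\mathbb{C}^n\}\in\Lambda(n)$, and $\mathcal{G}_\infty := 0\oplus\mathbb{C}^n$. $n_-$ is the number of negative eigenvalues counted with multiplicity. The Duistermaat index $\iota:\Lambda(n)^3\to\{0,\dots,n\}$ is the unique function such that (1) $\iota(\mathcal{G}_0,\mathcal{G}_A,\mathcal{G}_\infty)=n_-(A)$ for every Hermitian $A$; (2) $\iota(\mathsf{S}\mathcal{L}_1,\mathsf{S}\mathcal{L}_2,\mathsf{S}\mathcal{L}_3)=\iota(\mathcal{L}_1,\mathcal{L}_2,\mathcal{L}_3)$ for every linear symplectic transformation $\mathsf{S}$; (3) $\iota(\mathcal{L}_1,\mathcal{L}_2,\mathcal{L}_3)-\iota(\mathcal{L}_1,\mathcal{L}_2,\mathcal{L}_4)+\iota(\mathcal{L}_1,\mathcal{L}_3,\mathcal{L}_4)-\iota(\mathcal{L}_2,\mathcal{L}_3,\mathcal{L}_4)=0$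 for all Lagrangian planes. Explicitly, $\iota(\mathcal{L}_1,\mathcal{L}_2,\mathcal{L}_3)=n_-(\Omega)-n+\dim(\mathcal{L}_1\cap\mathcal{L}_3)$, where $\Omega$ is the Hermitian form on $\mathcal{L}_1\oplus\mathcal{L}_2\oplus\mathcal{L}_3$ given by $\Omega(u_1,u_2,u_3;v_1,v_2,v_3)=\omega(u_1,v_2)+\omega(u_2,v_3)+\omega(u_3,v_1)-\omega(u_2,v_1)-\omega(u_3,v_2)-\omega(u_1,v_3)$. *)

theory Defs
  imports "HOL-Analysis.Analysis"
begin

interpretation sympl: finite_dimensional_vector_space_prod
  "(*s) :: complex \<Rightarrow> complex^'n \<Rightarrow> complex^'n"
  "(*s) :: complex \<Rightarrow> complex^'n \<Rightarrow> complex^'n" cart_basis cart_basis ..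

definition cinner :: "complex^'n \<Rightarrow> complex^'n \<Rightarrow> complex" where
  "cinner x y = (\<Sum>i\<in>UNIV. cnj (x $ i) * y $ i)"

definition omega :: "(complex^'n) \<times> (complex^'n) \<Rightarrow> (complex^'n) \<times> (complex^'n) \<Rightarrow> complex" where
  "omega u v = cinner (fst u) (snd v) - cinner (snd u) (fst v)"

definition Lagrangian :: "((complex^'n) \<times> (complex^'n)) set set" where
  "Lagrangian = {L. sympl.p.subspace L \<and> L = {v. \<forall>u\<in>L. omega u v = 0}}"

definition symplectic :: "((complex^'n) \<times> (complex^'n) \<Rightarrow> (complex^'n) \<times> (complex^'n)) \<Rightarrow> bool" where
  "symplectic S \<longleftrightarrow> Vector_Spaces.linear sympl.scale sympl.scale S \<and>
     (\<forall>u v. omega (S u) (S v) = omega u v)"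

definition hermitian_matrix :: "complex^'n^'n \<Rightarrow> bool" where
  "hermitian_matrix A \<longleftrightarrow> (\<forall>i j. A $ i $ j = cnj (A $ j $ i))"

definition eigenspace :: "complex^'n^'n \<Rightarrow> complex \<Rightarrow> (complex^'n) set" where
  "eigenspace A l = {x. A *v x = l *s x}"

text \<open>The number of negative eigenvalues, each counted with its multiplicity. It is only applied
  to Hermitian matrices, for which algebraic and geometric multiplicities agree.\<close>

definition n_minus :: "complex^'n^'n \<Rightarrow> nat" where
  "n_minus A = (\<Sum>l\<in>{l::real. l < 0 \<and> (\<exists>x. x \<noteq> 0 \<and> A *v x = complex_of_real l *s x)}.
                  vec.dim (eigenspace A (complex_of_real l)))"

definition lagr_graph :: "complex^'n^'n \<Rightarrow> ((complex^'n) \<times> (complex^'n)) set" where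
  "lagr_graph M = {(x, M *v x) | x. True}"

definition lagr_graph_inf :: "((complex^'n) \<times> (complex^'n)) set" where
  "lagr_graph_inf = {0} \<times> UNIV"

text \<open>The defining properties of the Duistermaat index. The extensional function space makes a
  function on triples of Lagrangian planes unique as a total HOL function.\<close>

definition is_duistermaat_index ::
  "(((complex^'n) \<times> (complex^'n)) set \<times> ((complex^'n) \<times> (complex^'n)) set \<times>
    ((complex^'n) \<times> (complex^'n)) set \<Rightarrow> nat) \<Rightarrow> bool" where
  "is_duistermaat_index \<iota> \<longleftrightarrow>
     \<iota> \<in> (Lagrangian \<times> Lagrangian \<times> Lagrangian) \<rightarrow>\<^sub>E {0..CARD('n)} \<and>
     (\<forall>A. hermitian_matrix A \<longrightarrow> \<iota> (lagr_graph 0, lagr_graph A, lagr_graph_inf) = n_minus A) \<and>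
     (\<forall>S. symplectic S \<longrightarrow>
        (\<forall>L1\<in>Lagrangian. \<forall>L2\<in>Lagrangian. \<forall>L3\<in>Lagrangian.
           \<iota> (S ` L1, S ` L2, S ` L3) = \<iota> (L1, L2, L3))) \<and>
     (\<forall>L1\<in>Lagrangian. \<forall>L2\<in>Lagrangian. \<forall>L3\<in>Lagrangian. \<forall>L4\<in>Lagrangian.
        int (\<iota> (L1, L2, L3)) - int (\<iota> (L1, L2, L4)) + int (\<iota> (L1, L3, L4))
          - int (\<iota> (L2, L3, L4)) = 0)"

definition duistermaat_index ::
  "((complex^'n) \<times> (complex^'n)) set \<times> ((complex^'n) \<times> (complex^'n)) set \<times>
    ((complex^'n) \<times> (complex^'n)) set \<Rightarrow> nat" where
  "duistermaat_index = (THE \<iota>. is_duistermaat_index \<iota>)"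

end

theory Submission
  imports Defs
begin

text \<open>
  Any index with the three defining properties satisfies the formula: the cocycle identity for
  \<open>\<G>\<^sub>A, \<G>\<^sub>B, \<G>\<^sub>C, \<G>\<^sub>\<infinity>\<close> reduces it to the indices of \<open>(\<G>\<^sub>A, \<G>\<^sub>B, \<G>\<^sub>\<infinity>)\<close>, which a shear moves to
  \<open>(\<G>\<^sub>0, \<G>\<^bsub>B - A\<^esub>, \<G>\<^sub>\<infinity>)\<close>. The index exists and is unique because, for all but finitely many
  real \<open>t\<close>, the symplectic map \<open>(x, y) \<mapsto> (y - t x, - x)\<close> turns any finite set of Lagrangian planes
  into graphs of Hermitian matrices. Uniqueness follows at once; for existence, the
  explicit formula in terms of the form \<open>\<Omega>\<close> is symplectically invariant, and on graphs it equals
  \<open>n\<^sub>-(B - A) - n\<^sub>-(C - A) + n\<^sub>-(C - B)\<close>, from which the cocycle identity is evident.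
\<close>

section \<open>Negative index of a real quadratic form\<close>

text \<open>On graphs the form has negative index n_-(B - A) + n_-(C - B) + n_-(A - C), while
  inertia gives dim ker (C - A) + n_-(C - A) + n_-(A - C) = n. The correction term -n + dim (L1
  \<inter> L3) of the explicit formula therefore replaces n_-(A - C) by -n_-(C - A). That the result
  lies between 0 and n is the pair of bounds n_-(X + Y) \<le> n_-(X) + n_-(Y) \<le> n + n_-(X + Y),
  which come from counting dimensions. The normalisation (1) needs a diagonalisation of its own,
  since the vertical plane is not a graph.

  The negative index of a form is taken as the largest dimension of a negative definite real
  subspace, not as a count of eigenvalues: it then makes sense on any product of planes and survives
  every injective linear substitution. All dimensions are real, so every complex count appears
  doubled; this is the origin of the factors 2 and of the final halving.\<close>

definition neg_index :: "('a::euclidean_space \<Rightarrow> real) \<Rightarrow> 'a set \<Rightarrow> nat" where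
  "neg_index q V = Max {dim W | W. subspace W \<and> W \<subseteq> V \<and> (\<forall>x\<in>W. x \<noteq> 0 \<longrightarrow> q x < 0)}"

lemma dim_add_le_if_Int_trivial:
  fixes W P V :: "'a::euclidean_space set"
  assumes "subspace W" "subspace P" "subspace V" "W \<subseteq> V" "P \<subseteq> V" "W \<inter> P \<subseteq> {0}"
  shows "dim W + dim P \<le> dim V"
proof -
  have "dim {x + y |x y. x \<in> W \<and> y \<in> P} + dim (W \<inter> P) = dim W + dim P"
    by (rule dim_sums_Int) (use assms in auto)
  moreover have "dim (W \<inter> P) = 0"
    using assms(6) by (simp add: dim_eq_0)
  moreover have "dim {x + y |x y. x \<in> W \<and> y \<in> P} \<le> dim V"
    by (rule dim_subset) (use assms subspace_add in blast)
  ultimately show ?thesis by simp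
qed

text \<open>On a common nonzero vector of \<open>W\<close> and \<open>P\<close> the form would be
  both negative and nonnegative, so
  \<open>dim W + dim P \<le> dim V \<le> dim N + dim P\<close>.\<close>

lemma dim_neg_def_le:
  fixes N P V W :: "'a::euclidean_space set" and q :: "'a \<Rightarrow> real"
  assumes N: "subspace N" and P: "subspace P"
    and V: "V = {x + y |x y. x \<in> N \<and> y \<in> P}"
    and Pnn: "\<And>x. x \<in> P \<Longrightarrow> q x \<ge> 0"
    and W: "subspace W" "W \<subseteq> V" and Wneg: "\<And>x. x \<in> W \<Longrightarrow> x \<noteq> 0 \<Longrightarrow> q x < 0"
  shows "dim W \<le> dim N"
proof -
  have sV: "subspace V"
    unfolding V by (rule subspace_sums[OF N P])
  have PV: "P \<subseteq> V"
    unfolding V using subspace_0[OF N] by force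
  have "W \<inter> P \<subseteq> {0}"
  proof
    fix x assume "x \<in> W \<inter> P"
    then show "x \<in> {0}"
      using Pnn[of x] Wneg[of x] by (cases "x = 0") auto
  qed
  then have "dim W + dim P \<le> dim V"
    by (rule dim_add_le_if_Int_trivial[OF W(1) P sV W(2) PV])
  moreover have "dim V \<le> dim N + dim P"
    using dim_sums_Int[OF N P] unfolding V by linarith
  ultimately show ?thesis by simp
qed

text \<open>Sylvester's law of inertia in usable form: exhibiting a single splitting computes the
  index, because \<open>N\<close> attains the bound of \<open>dim_neg_def_le\<close>.\<close>

lemma neg_index_eqI:
  fixes N P V :: "'a::euclidean_space set"
  assumes N: "subspace N" and P: "subspace P"
    and V: "V = {x + y |x y. x \<in> N \<and> y \<in> P}"
    and neg: "\<And>x. x \<in> N \<Longrightarrow> x \<noteq> 0 \<Longrightarrow> q x < 0"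
    and Pnn: "\<And>x. x \<in> P \<Longrightarrow> q x \<ge> 0"
  shows "neg_index q V = dim N"
  unfolding neg_index_def
proof (rule Max_eqI)
  show "finite {dim W |W. subspace W \<and> W \<subseteq> V \<and> (\<forall>x\<in>W. x \<noteq> 0 \<longrightarrow> q x < 0)}"
    by (rule finite_subset[of _ "{..DIM('a)}"]) (auto simp: dim_subset_UNIV)
  show "y \<le> dim N"
    if "y \<in> {dim W |W. subspace W \<and> W \<subseteq> V \<and> (\<forall>x\<in>W. x \<noteq> 0 \<longrightarrow> q x < 0)}" for y
    using that by (auto intro: dim_neg_def_le[OF N P V Pnn])
  have "N \<subseteq> V"
  proof
    fix x assume "x \<in> N"
    then show "x \<in> V"
      unfolding V using subspace_0[OF P] by (intro CollectI exI[of _ x] exI[of _ 0]) simp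
  qed
  then show "dim N \<in> {dim W |W. subspace W \<and> W \<subseteq> V \<and> (\<forall>x\<in>W. x \<noteq> 0 \<longrightarrow> q x < 0)}"
    using N neg by (intro CollectI exI[of _ N]) simp
qed

text \<open>Images and preimages under \<open>f\<close> match the negative definite subspaces of
  both sides and keep dimensions. This serves the diagonalising substitutions as well as the
  invariance under symplectic maps.\<close>

lemma neg_index_image:
  fixes f :: "'a::euclidean_space \<Rightarrow> 'b::euclidean_space"
  assumes f: "linear f" and inj: "inj f"
  shows "neg_index q (f ` V) = neg_index (q \<circ> f) V"
proof -
  have "{dim W |W. subspace W \<and> W \<subseteq> f ` V \<and> (\<forall>x\<in>W. x \<noteq> 0 \<longrightarrow> q x < 0)} =
        {dim W |W. subspace W \<and> W \<subseteq> V \<and> (\<forall>x\<in>W. x \<noteq> 0 \<longrightarrow> (q \<circ> f) x < 0)}" (is "?L = ?R")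
  proof (intro set_eqI iffI)
    fix d assume "d \<in> ?L"
    then obtain W where W: "d = dim W" "subspace W" "W \<subseteq> f ` V" "\<forall>x\<in>W. x \<noteq> 0 \<longrightarrow> q x < 0"
      by blast
    have eq: "f ` (f -` W) = W"
      using W(3) by auto
    have "dim (f -` W) = d"
      using dim_image_eq[OF f, of "f -` W"] inj eq W(1) inj_on_subset[OF inj] by fastforce
    moreover have "subspace (f -` W)"
      by (rule linear_subspace_vimage[OF f W(2)])
    moreover have "f -` W \<subseteq> V"
      using W(3) inj by (auto simp: inj_def)
    moreover have "\<forall>x\<in>f -` W. x \<noteq> 0 \<longrightarrow> (q \<circ> f) x < 0"
      using W(4) inj linear_0[OF f] by (metis comp_apply injD vimage_eq)
    ultimately show "d \<in> ?R"
      by blast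
  next
    fix d assume "d \<in> ?R"
    then obtain W where W: "d = dim W" "subspace W" "W \<subseteq> V" "\<forall>x\<in>W. x \<noteq> 0 \<longrightarrow> (q \<circ> f) x < 0"
      by blast
    have "dim (f ` W) = d"
      using dim_image_eq[OF f, of W] inj W(1) inj_on_subset[OF inj] by fastforce
    moreover have "subspace (f ` W)"
      by (rule linear_subspace_image[OF f W(2)])
    moreover have "\<forall>x\<in>f ` W. x \<noteq> 0 \<longrightarrow> q x < 0"
      using W(4) linear_0[OF f] by auto
    ultimately show "d \<in> ?L"
      using W(3) by blast
  qed
  then show ?thesis
    by (simp add: neg_index_def)
qed

section \<open>The Hermitian inner product\<close>

lemma Re_cinner: "Re (cinner x y) = x \<bullet> y"
  by (simp add: cinner_def inner_vec_def inner_complex_def)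

lemma cinner_add_left: "cinner (x + y) z = cinner x z + cinner y z"
  and cinner_add_right: "cinner z (x + y) = cinner z x + cinner z y"
  and cinner_diff_left: "cinner (x - y) z = cinner x z - cinner y z"
  and cinner_diff_right: "cinner z (x - y) = cinner z x - cinner z y"
  and cinner_scale_left: "cinner (c *s x) z = cnj c * cinner x z"
  and cinner_scale_right: "cinner z (c *s x) = c * cinner z x"
  and cinner_minus_left: "cinner (- x) z = - cinner x z"
  and cinner_minus_right: "cinner z (- x) = - cinner z x"
  and cinner_zero_left: "cinner 0 z = 0"
  and cinner_zero_right: "cinner z 0 = 0"
  by (simp_all add: cinner_def algebra_simps sum.distrib sum_subtractf sum_distrib_left sum_negf)

lemmas cinner_simps = cinner_add_left cinner_add_right cinner_diff_left cinner_diff_right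
  cinner_scale_left cinner_scale_right cinner_minus_left cinner_minus_right
  cinner_zero_left cinner_zero_right

lemma cinner_sum_right: "cinner z (\<Sum>i\<in>I. f i) = (\<Sum>i\<in>I. cinner z (f i))"
  by (induction I rule: infinite_finite_induct) (simp_all add: cinner_simps)

lemma cnj_cinner: "cnj (cinner x y) = cinner y x"
  by (simp add: cinner_def mult.commute)

lemma cinner_self: "cinner x x = complex_of_real ((norm x)\<^sup>2)"
proof (rule complex_eqI)
  show "Re (cinner x x) = Re (complex_of_real ((norm x)\<^sup>2))"
    by (simp add: Re_cinner power2_norm_eq_inner del: of_real_power)
  have "cnj (cinner x x) = cinner x x"
    by (rule cnj_cinner)
  then show "Im (cinner x x) = Im (complex_of_real ((norm x)\<^sup>2))"
    by (simp add: complex_eq_iff del: of_real_power)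
qed

lemma cinner_self_eq_0: "cinner x x = 0 \<longleftrightarrow> x = 0"
  by (simp add: cinner_self)

lemma scaleR_eq_vector_scalar_mult: "r *\<^sub>R x = complex_of_real r *s (x :: complex^'n)"
  by (simp add: vec_eq_iff scaleR_conv_of_real[where 'a = complex])

lemma subspace_if_vec_subspace: "vec.subspace (V :: (complex^'n) set) \<Longrightarrow> subspace V"
  by (simp add: vec.subspace_def subspace_def scaleR_eq_vector_scalar_mult)

lemma vec_subspace_cinner_eq_0: "vec.subspace {x. \<forall>b\<in>B. cinner b x = 0}"
  by (auto simp: vec.subspace_def cinner_simps)

lemma cinner_span_eq_0:
  assumes "\<And>b. b \<in> B \<Longrightarrow> cinner b x = 0" and "y \<in> vec.span B"
  shows "cinner y x = 0"
  using assms(2) by (induction rule: vec.span_induct_alt) (auto simp: cinner_simps assms(1))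

text \<open>Real orthogonality kills the real part of \<open>cinner v y\<close>; applied to
  \<open>\<i> *s v\<close>, which also lies in \<open>V\<close>, it kills the imaginary part. Real
  dimension theory thus yields Hermitian orthogonality.\<close>

lemma cinner_eq_0_if_inner_eq_0:
  assumes V: "vec.subspace V" and orth: "\<And>v. v \<in> V \<Longrightarrow> v \<bullet> y = 0" and v: "v \<in> V"
  shows "cinner v y = 0"
proof -
  have "Re (cinner v y) = 0"
    using orth[OF v] by (simp add: Re_cinner)
  moreover have "Re (cinner (\<i> *s v) y) = 0"
    using orth vec.subspace_scale[OF V v] by (simp add: Re_cinner)
  ultimately show ?thesis
    by (simp add: cinner_simps complex_eq_iff)
qed

lemma ex_cinner_orthogonal:
  assumes V: "vec.subspace (V :: (complex^'n) set)" and "V \<noteq> UNIV"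
  obtains y where "y \<noteq> 0" "\<And>v. v \<in> V \<Longrightarrow> cinner v y = 0"
proof -
  have sV: "subspace V"
    by (rule subspace_if_vec_subspace[OF V])
  have "dim V \<noteq> DIM(complex^'n)"
    using \<open>V \<noteq> UNIV\<close> sV dim_eq_full[of V] span_eq_iff[of V] by metis
  then have "dim V < DIM(complex^'n)"
    using dim_subset_UNIV[of V] by linarith
  then obtain y where y: "y \<noteq> 0" "\<And>v. v \<in> span V \<Longrightarrow> orthogonal y v"
    using orthogonal_to_subspace_exists by blast
  have "v \<bullet> y = 0" if "v \<in> V" for v
    using y(2)[of v] that span_base by (auto simp: orthogonal_def inner_commute)
  then show ?thesis
    using that y(1) cinner_eq_0_if_inner_eq_0[OF V] by blast
qed

lemma hermitian_cinner:
  assumes "hermitian_matrix A"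
  shows "cinner (A *v x) y = cinner x (A *v y)"
proof -
  have "cinner (A *v x) y = (\<Sum>i\<in>UNIV. \<Sum>j\<in>UNIV. cnj (A $ i $ j) * cnj (x $ j) * y $ i)"
    by (simp add: cinner_def matrix_vector_mult_def sum_distrib_right)
  also have "\<dots> = (\<Sum>j\<in>UNIV. \<Sum>i\<in>UNIV. cnj (A $ i $ j) * cnj (x $ j) * y $ i)"
    by (rule sum.swap)
  also have "\<dots> = (\<Sum>j\<in>UNIV. \<Sum>i\<in>UNIV. cnj (x $ j) * (A $ j $ i * y $ i))"
    using assms by (intro sum.cong refl) (metis (no_types, lifting) hermitian_matrix_def mult.assoc mult.commute)
  also have "\<dots> = cinner x (A *v y)"
    by (simp add: cinner_def matrix_vector_mult_def sum_distrib_left)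
  finally show ?thesis .
qed

lemma hermitian_if_cinner:
  assumes "\<And>x y. cinner (A *v x) y = cinner x (A *v y)"
  shows "hermitian_matrix A"
  unfolding hermitian_matrix_def
proof (intro allI)
  fix i j
  have "cinner (axis i 1) y = y $ i" for y :: "complex^'n" and i
    by (simp add: cinner_def axis_def if_distrib[of cnj] if_distrib[of "\<lambda>a. a * _"] cong: if_cong)
  moreover have "cinner y (axis j 1) = cnj (y $ j)" for y :: "complex^'n" and j
    by (simp add: cinner_def axis_def if_distrib cong: if_cong)
  moreover have "(A *v axis j 1) $ i = A $ i $ j" for i j
    by (simp add: matrix_vector_mult_def axis_def if_distrib cong: if_cong)
  ultimately show "A $ i $ j = cnj (A $ j $ i)"
    using assms[of "axis i 1" "axis j 1"] by metis
qed

lemma hermitian_inner: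
  "hermitian_matrix A \<Longrightarrow> (A *v x) \<bullet> y = x \<bullet> (A *v y)"
  by (metis hermitian_cinner Re_cinner)

lemma hermitian_diff: "hermitian_matrix A \<Longrightarrow> hermitian_matrix B \<Longrightarrow> hermitian_matrix (A - B)"
  unfolding hermitian_matrix_def by (metis complex_cnj_diff vector_minus_component)

lemma hermitian_uminus: "hermitian_matrix A \<Longrightarrow> hermitian_matrix (- A)"
  unfolding hermitian_matrix_def by (metis complex_cnj_minus vector_uminus_component)

lemma linear_complex_matrix_vector_mult: "linear ((*v) (A :: complex^'n^'m))"
  by (rule linearI) (simp_all only: matrix_vector_right_distrib scaleR_eq_vector_scalar_mult vec.scale)

lemma uminus_matrix_mult: "(- A) *v x = - (A *v (x :: complex^'n))"
  by (simp add: matrix_vector_mult_def vec_eq_iff sum_negf)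

lemma complex_matrix_mult_scaleR: "(A :: complex^'n^'m) *v (r *\<^sub>R x) = r *\<^sub>R (A *v x)"
  by (rule linear_scale[OF linear_complex_matrix_vector_mult])

section \<open>Spectral theorem for Hermitian matrices\<close>

text \<open>The first-order condition at a maximum without derivatives: for small \<open>t\<close> a
  nonzero linear term would outweigh the quadratic one.\<close>

lemma eq_0_if_linear_le_quadratic:
  fixes b c :: real
  assumes "\<And>t. 2 * t * b \<le> t\<^sup>2 * c"
  shows "b = 0"
proof (rule ccontr)
  assume b: "b \<noteq> 0"
  \<comment> \<open>Chosen so that \<open>t\<^sup>2 * (\<bar>c\<bar> + 1) = t * b\<close>; the
    hypothesis then gives \<open>2 * t * b \<le> t * b\<close> although \<open>t * b > 0\<close>.
    The 1 keeps the denominator positive.\<close>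
  define t where "t = b / (\<bar>c\<bar> + 1)"
  have "t\<^sup>2 * c \<le> t\<^sup>2 * (\<bar>c\<bar> + 1)"
    by (intro mult_left_mono) auto
  also have "\<dots> = t * b"
    by (simp add: t_def power2_eq_square)
  finally have "2 * t * b \<le> t * b"
    using assms[of t] by linarith
  moreover have "t * b = b\<^sup>2 / (\<bar>c\<bar> + 1)"
    by (simp add: t_def power2_eq_square)
  moreover have "b\<^sup>2 / (\<bar>c\<bar> + 1) > 0"
    using b by (intro divide_pos_pos) auto
  ultimately show False by linarith
qed

text \<open>The eigenvector maximises the Rayleigh quotient on the invariant subspace.\<close>

lemma hermitian_eigenvector_in_subspace:
  fixes A :: "complex^'n^'n"
  assumes A: "hermitian_matrix A" and V: "vec.subspace V"
    and inv: "\<And>x. x \<in> V \<Longrightarrow> A *v x \<in> V" and ne: "y \<in> V" "y \<noteq> 0"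
  obtains x where "x \<in> V" "norm x = 1" "A *v x = complex_of_real (x \<bullet> (A *v x)) *s x"
proof -
  define S where "S = sphere 0 1 \<inter> V"
  have sV: "subspace V"
    by (rule subspace_if_vec_subspace[OF V])
  have "compact S"
    unfolding S_def by (intro compact_Int_closed compact_sphere closed_subspace sV)
  moreover have "y /\<^sub>R norm y \<in> S"
    using ne subspace_scale[OF sV] by (simp add: S_def)
  moreover have "continuous_on S (\<lambda>x. x \<bullet> (A *v x))"
    by (intro continuous_intros linear_continuous_on_compose[OF _ linear_complex_matrix_vector_mult])
  ultimately obtain x where x: "x \<in> S" and max: "\<And>z. z \<in> S \<Longrightarrow> z \<bullet> (A *v z) \<le> x \<bullet> (A *v x)"
    using continuous_attains_sup[of S "\<lambda>x. x \<bullet> (A *v x)"] by blast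
  define l where "l = x \<bullet> (A *v x)"
  have xV: "x \<in> V" and nx: "norm x = 1"
    using x by (auto simp: S_def)
  have le: "z \<bullet> (A *v z) \<le> l * (z \<bullet> z)" if z: "z \<in> V" for z
  proof (cases "z = 0")
    case False
    then have "z /\<^sub>R norm z \<in> S"
      using z subspace_scale[OF sV] by (simp add: S_def)
    from max[OF this] have "(z \<bullet> (A *v z)) / (norm z)\<^sup>2 \<le> l"
      by (simp add: l_def linear_scale[OF linear_complex_matrix_vector_mult] power2_eq_square
          divide_simps)
    then show ?thesis
      using False by (simp add: divide_simps power2_norm_eq_inner)
  qed simp
  \<comment> \<open>The residual stays in \<open>V\<close> by invariance. Moving \<open>x\<close> in
    direction \<open>w\<close> makes the inequality \<open>le\<close> read
    \<open>2 * t * (w \<bullet> w) \<le> t\<^sup>2 * _\<close>, which forces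
    \<open>w = 0\<close>.\<close>
  define w where "w = A *v x - l *\<^sub>R x"
  have wV: "w \<in> V"
    unfolding w_def by (intro subspace_diff subspace_scale sV inv xV)
  have "w \<bullet> w = 0"
  proof (rule eq_0_if_linear_le_quadratic)
    fix t :: real
    have "(x + t *\<^sub>R w) \<bullet> (A *v (x + t *\<^sub>R w)) \<le> l * ((x + t *\<^sub>R w) \<bullet> (x + t *\<^sub>R w))"
      by (intro le subspace_add subspace_scale sV xV wV)
    moreover have "(x + t *\<^sub>R w) \<bullet> (A *v (x + t *\<^sub>R w)) =
        l + 2 * t * (w \<bullet> (A *v x)) + t\<^sup>2 * (w \<bullet> (A *v w))"
    proof -
      have "x \<bullet> (A *v w) = w \<bullet> (A *v x)"
        using hermitian_inner[OF A, of x w] by (simp add: inner_commute)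
      then show ?thesis
        by (simp add: linear_add[OF linear_complex_matrix_vector_mult]
            linear_scale[OF linear_complex_matrix_vector_mult] inner_add_left inner_add_right l_def
            power2_eq_square algebra_simps)
    qed
    moreover have "(x + t *\<^sub>R w) \<bullet> (x + t *\<^sub>R w) = 1 + 2 * t * (w \<bullet> x) + t\<^sup>2 * (w \<bullet> w)"
      using nx by (simp add: inner_add_left inner_add_right inner_commute[of x w] power2_eq_square
          norm_eq_1 algebra_simps)
    ultimately have "l + 2 * t * (w \<bullet> (A *v x)) + t\<^sup>2 * (w \<bullet> (A *v w))
        \<le> l * (1 + 2 * t * (w \<bullet> x) + t\<^sup>2 * (w \<bullet> w))"
      by simp
    then have "2 * t * (w \<bullet> (A *v x) - l * (w \<bullet> x)) \<le> t\<^sup>2 * (l * (w \<bullet> w) - w \<bullet> (A *v w))"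
      by (simp add: algebra_simps)
    then show "2 * t * (w \<bullet> w) \<le> t\<^sup>2 * (l * (w \<bullet> w) - w \<bullet> (A *v w))"
      by (simp add: w_def inner_diff_right)
  qed
  then have "A *v x = l *\<^sub>R x"
    by (simp add: w_def)
  then show ?thesis
    using that xV nx by (simp only: l_def scaleR_eq_vector_scalar_mult)
qed

definition cinner_orthonormal :: "(complex^'n) set \<Rightarrow> bool" where
  "cinner_orthonormal B \<longleftrightarrow> (\<forall>b\<in>B. \<forall>c\<in>B. cinner b c = (if b = c then 1 else 0))"

lemma cinner_orthonormalD:
  "cinner_orthonormal B \<Longrightarrow> b \<in> B \<Longrightarrow> c \<in> B \<Longrightarrow> cinner b c = (if b = c then 1 else 0)"
  by (simp add: cinner_orthonormal_def)

lemma cinner_orthonormal_subset: "cinner_orthonormal B \<Longrightarrow> C \<subseteq> B \<Longrightarrow> cinner_orthonormal C"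
  unfolding cinner_orthonormal_def by blast

text \<open>A real basis of the complex span is the union of the set with its multiple by \<open>\<i>\<close>.\<close>

lemma cinner_orthonormal_dims:
  fixes B :: "(complex^'n) set"
  assumes B: "cinner_orthonormal B"
  shows "finite B" "card B \<le> DIM(complex^'n)" "vec.dim (vec.span B) = card B"
    "dim (vec.span B) = 2 * card B"
proof -
  define B' where "B' = B \<union> (\<lambda>b. \<i> *s b) ` B"
  have i: "b \<bullet> (\<i> *s c) = 0" if "b \<in> B" "c \<in> B" for b c
    using cinner_orthonormalD[OF B that] by (simp add: cinner_simps flip: Re_cinner)
  have i': "(\<i> *s b) \<bullet> c = 0" if "b \<in> B" "c \<in> B" for b c
    using i[OF that(2,1)] by (simp add: inner_commute)
  have r: "b \<bullet> c = (if b = c then 1 else 0)" if "b \<in> B" "c \<in> B" for b c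
    using cinner_orthonormalD[OF B that] by (simp flip: Re_cinner)
  have ii: "(\<i> *s b) \<bullet> (\<i> *s c) = b \<bullet> c" for b c :: "complex^'n"
    by (simp add: cinner_simps flip: Re_cinner)
  have n0: "0 \<notin> B'"
    using r ii unfolding B'_def by (metis (no_types, lifting) UnE imageE inner_zero_left zero_neq_one)
  have orth: "pairwise orthogonal B'"
    unfolding B'_def pairwise_def orthogonal_def using i i' r ii by auto
  have ind: "independent B'"
    by (rule pairwise_orthogonal_independent[OF orth n0])
  have finB': "finite B'"
    using independent_bound[OF ind] by simp
  then show finB: "finite B"
    by (simp add: B'_def)
  have "card B \<le> card B'"
    using finB' by (intro card_mono) (auto simp: B'_def)
  \<comment> \<open>Crude by a factor 2, but any bound independent of \<open>B\<close> permits
    choosing a largest orthonormal set of eigenvectors later.\<close>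
  then show "card B \<le> DIM(complex^'n)"
    using independent_bound[OF ind] by simp
  have "vec.independent B"
  proof
    assume "vec.dependent B"
    then obtain b where b: "b \<in> B" "b \<in> vec.span (B - {b})"
      unfolding vec.dependent_def by blast
    have "cinner b b = 0"
      by (rule cinner_span_eq_0[OF _ b(2)]) (use b cinner_orthonormalD[OF B] in auto)
    then show False
      using cinner_orthonormalD[OF B b(1) b(1)] by simp
  qed
  then show "vec.dim (vec.span B) = card B"
    by (simp add: vec.dim_eq_card_independent)
  have "B \<inter> (\<lambda>b. \<i> *s b) ` B = {}"
  proof -
    have False if "b \<in> B" "c \<in> B" "b = \<i> *s c" for b c
      using i[OF that(1,2)] r[OF that(1,1)] that(3) by simp
    then show ?thesis by blast
  qed
  moreover have "inj_on (\<lambda>b. \<i> *s b) B"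
    by (auto simp: inj_on_def)
  ultimately have "card B' = 2 * card B"
    unfolding B'_def using finB by (simp add: card_Un_disjoint card_image)
  moreover have "span B' = vec.span B"
  proof
    show "span B' \<subseteq> vec.span B"
      by (rule span_minimal)
        (auto simp: B'_def subspace_if_vec_subspace intro: vec.span_base vec.span_scale)
    \<comment> \<open>A real subspace closed under multiplication by \<open>\<i>\<close> is a
      complex one, and \<open>B'\<close> is closed up to sign because
      \<open>\<i> *s (\<i> *s d) = - d\<close>.\<close>
    have "vec.subspace (span B')"
    proof (rule vec.subspaceI)
      have im: "\<i> *s x \<in> span B'" if "x \<in> span B'" for x
        using that
      proof (induction rule: span_induct_alt)
        case (step c b x)
        have "\<i> *s b \<in> span B'"
        proof (cases "b \<in> B")
          case True
          then show ?thesis by (auto simp: B'_def intro: span_base)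
        next
          case False
          then obtain d where d: "d \<in> B" "b = \<i> *s d"
            using step by (auto simp: B'_def)
          then have "\<i> *s b = - d"
            by (simp add: vec_eq_iff)
          moreover have "d \<in> span B'"
            using d by (auto simp: B'_def intro: span_base)
          ultimately show ?thesis
            by (simp add: span_neg)
        qed
        moreover have "\<i> *s (c *\<^sub>R b + x) = c *\<^sub>R (\<i> *s b) + \<i> *s x"
          by (simp add: vec_eq_iff algebra_simps)
        ultimately show ?case
          using step by (simp add: span_add span_scale)
      qed (simp add: span_0)
      show "c *s x \<in> span B'" if "x \<in> span B'" for c x
      proof -
        have "c *s x = Re c *\<^sub>R x + Im c *\<^sub>R (\<i> *s x)"
          by (simp add: vec_eq_iff complex_eq_iff)
        then show ?thesis
          using that im by (simp add: span_add span_scale)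
      qed
    qed (auto intro: span_add span_0)
    then show "vec.span B \<subseteq> span B'"
      by (intro vec.span_minimal) (auto simp: B'_def intro: span_base)
  qed
  ultimately show "dim (vec.span B) = 2 * card B"
    using dim_eq_card_independent[OF ind] dim_span[of B'] by simp
qed

section \<open>Sign counts in an orthonormal eigenbasis\<close>

locale orthonormal_eigenbasis =
  fixes A :: "complex^'n^'n" and B :: "(complex^'n) set" and l :: "complex^'n \<Rightarrow> real"
  assumes orthonormal: "cinner_orthonormal B"
    and span_B: "vec.span B = UNIV"
    and eigen: "b \<in> B \<Longrightarrow> A *v b = complex_of_real (l b) *s b"
    and hermitian: "hermitian_matrix A"
begin

lemma finite_B: "finite B"
  by (rule cinner_orthonormal_dims(1)[OF orthonormal])

lemma card_B: "card B = CARD('n)"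
  using cinner_orthonormal_dims(4)[OF orthonormal] by (simp add: span_B)

lemma cinner_basis: "b \<in> B \<Longrightarrow> c \<in> B \<Longrightarrow> cinner b c = (if b = c then 1 else 0)"
  by (rule cinner_orthonormalD[OF orthonormal])

text \<open>The difference of the two sides is orthogonal to \<open>B\<close>, hence to the span of
  \<open>B\<close>, which contains the difference itself.\<close>

lemma expansion: "x = (\<Sum>b\<in>B. cinner b x *s b)"
proof -
  define y where "y = x - (\<Sum>b\<in>B. cinner b x *s b)"
  have "cinner c y = 0" if c: "c \<in> B" for c
  proof -
    have "cinner c (\<Sum>b\<in>B. cinner b x *s b) = (\<Sum>b\<in>B. if c = b then cinner b x else 0)"
      unfolding cinner_sum_right cinner_scale_right
      using c by (intro sum.cong) (auto simp: cinner_basis)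
    also have "\<dots> = cinner c x"
      using c finite_B by simp
    finally show ?thesis
      by (simp add: y_def cinner_simps)
  qed
  moreover have "y \<in> vec.span B"
    unfolding span_B by (rule UNIV_I)
  ultimately have "cinner y y = 0"
    by (rule cinner_span_eq_0)
  then show ?thesis
    by (simp add: y_def cinner_self_eq_0)
qed

lemma span_subset_iff:
  assumes "C \<subseteq> B"
  shows "x \<in> vec.span C \<longleftrightarrow> (\<forall>b\<in>B - C. cinner b x = 0)"
proof
  assume x: "x \<in> vec.span C"
  have "cinner x b = 0" if "b \<in> B - C" for b
    by (rule cinner_span_eq_0[OF _ x]) (use that assms in \<open>auto simp: cinner_basis\<close>)
  then show "\<forall>b\<in>B - C. cinner b x = 0"
    by (metis cnj_cinner complex_cnj_zero)
next
  assume "\<forall>b\<in>B - C. cinner b x = 0"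
  then have "(\<Sum>b\<in>B. cinner b x *s b) = (\<Sum>b\<in>C. cinner b x *s b)"
    using assms finite_B by (intro sum.mono_neutral_right) auto
  then have "x = (\<Sum>b\<in>C. cinner b x *s b)"
    using expansion[of x] by simp
  then show "x \<in> vec.span C"
    by (metis (no_types, lifting) vec.span_sum vec.span_scale vec.span_base)
qed

lemma cinner_basis_mult: "b \<in> B \<Longrightarrow> cinner b (A *v x) = complex_of_real (l b) * cinner b x"
  using hermitian_cinner[OF hermitian, of b x] by (simp add: eigen cinner_simps)

lemma quadratic_form: "x \<bullet> (A *v x) = (\<Sum>b\<in>B. l b * (cmod (cinner b x))\<^sup>2)"
proof -
  have "cinner x (A *v x) = cinner x (\<Sum>b\<in>B. cinner b (A *v x) *s b)"
    using expansion[of "A *v x"] by simp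
  also have "\<dots> = (\<Sum>b\<in>B. complex_of_real (l b) * (cinner b x * cinner x b))"
    by (simp add: cinner_sum_right cinner_simps cinner_basis_mult mult.assoc)
  also have "\<dots> = (\<Sum>b\<in>B. complex_of_real (l b * (cmod (cinner b x))\<^sup>2))"
    by (intro sum.cong refl)
      (simp only: of_real_mult complex_norm_square cnj_cinner)
  finally show ?thesis
    by (simp flip: Re_cinner del: of_real_mult)
qed

text \<open>Comparing coefficients, \<open>A *v x = complex_of_real t *s x\<close> means
  \<open>l b * cinner b x = t * cinner b x\<close> for every \<open>b\<close>, so only basis vectors
  with \<open>l b = t\<close> contribute.\<close>

lemma eigenspace_eq_span: "eigenspace A (complex_of_real t) = vec.span {b \<in> B. l b = t}"
proof -
  have "A *v x = complex_of_real t *s x \<longleftrightarrow> (\<forall>b\<in>B - {b \<in> B. l b = t}. cinner b x = 0)" for x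
  proof
    assume "A *v x = complex_of_real t *s x"
    then have "complex_of_real (l b) * cinner b x = complex_of_real t * cinner b x" if "b \<in> B" for b
      using cinner_basis_mult[OF that, of x] by (simp only: cinner_simps)
    then show "\<forall>b\<in>B - {b \<in> B. l b = t}. cinner b x = 0"
      by auto
  next
    assume *: "\<forall>b\<in>B - {b \<in> B. l b = t}. cinner b x = 0"
    have "A *v x = (\<Sum>b\<in>B. cinner b (A *v x) *s b)"
      by (rule expansion)
    also have "\<dots> = (\<Sum>b\<in>B. cinner b (complex_of_real t *s x) *s b)"
      using * by (intro sum.cong refl) (auto simp: cinner_basis_mult cinner_simps)
    also have "\<dots> = complex_of_real t *s x"
      by (rule expansion[symmetric])
    finally show "A *v x = complex_of_real t *s x" .
  qed
  then show ?thesis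
    unfolding eigenspace_def using span_subset_iff[of "{b \<in> B. l b = t}"] by auto
qed

lemma basis_neq_0: "b \<in> B \<Longrightarrow> b \<noteq> 0"
  using cinner_basis[of b b] by (auto simp: cinner_simps)

text \<open>The eigenvalues occurring are the values of \<open>l\<close>, and the sum over
  eigenspace dimensions counts the negative basis vectors grouped by eigenvalue.\<close>

lemma n_minus_eq_card: "n_minus A = card {b \<in> B. l b < 0}"
proof -
  let ?C = "{b \<in> B. l b < 0}"
  have "{t. t < 0 \<and> (\<exists>x. x \<noteq> 0 \<and> A *v x = complex_of_real t *s x)} = l ` ?C" (is "?L = _")
  proof (intro set_eqI iffI)
    fix t assume "t \<in> ?L"
    then obtain x where t: "t < 0" and x: "x \<noteq> 0" "x \<in> eigenspace A (complex_of_real t)"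
      by (auto simp: eigenspace_def)
    then have "x \<in> vec.span {b \<in> B. l b = t}"
      by (simp add: eigenspace_eq_span)
    then have "{b \<in> B. l b = t} \<noteq> {}"
      using x(1) by (metis empty_iff insert_iff vec.span_empty)
    then show "t \<in> l ` ?C"
      using t by auto
  qed (use eigen basis_neq_0 in auto)
  then have "n_minus A = (\<Sum>t\<in>l ` ?C. card {b \<in> B. l b = t})"
    unfolding n_minus_def eigenspace_eq_span
    by (simp add: cinner_orthonormal_dims(3)[OF cinner_orthonormal_subset[OF orthonormal]]
        del: vec.dim_span)
  also have "\<dots> = card (\<Union>t\<in>l ` ?C. {b \<in> B. l b = t})"
    using finite_B by (subst card_UN_disjoint) auto
  also have "(\<Union>t\<in>l ` ?C. {b \<in> B. l b = t}) = ?C"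
    by auto
  finally show ?thesis .
qed

lemma dim_span_subset: "C \<subseteq> B \<Longrightarrow> dim (vec.span C) = 2 * card C"
  by (rule cinner_orthonormal_dims(4)[OF cinner_orthonormal_subset[OF orthonormal]])

lemma quadratic_form_neg:
  assumes "x \<in> vec.span {b \<in> B. l b < 0}" "x \<noteq> 0"
  shows "x \<bullet> (A *v x) < 0"
proof -
  have 0: "\<forall>b\<in>B - {b \<in> B. l b < 0}. cinner b x = 0"
    using assms(1) span_subset_iff[of "{b \<in> B. l b < 0}"] by auto
  have "\<exists>b\<in>B. cinner b x \<noteq> 0"
    using expansion[of x] \<open>x \<noteq> 0\<close> by (metis (no_types, lifting) sum.neutral vec.scale_zero_left)
  then obtain b where b: "b \<in> B" "cinner b x \<noteq> 0"
    by blast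
  have "(\<Sum>b\<in>B. l b * (cmod (cinner b x))\<^sup>2) < (\<Sum>b\<in>B. 0)"
  proof (rule sum_strict_mono_ex1)
    show "\<forall>b\<in>B. l b * (cmod (cinner b x))\<^sup>2 \<le> 0"
    proof
      fix b assume "b \<in> B"
      then show "l b * (cmod (cinner b x))\<^sup>2 \<le> 0"
        using 0 by (cases "l b < 0") (auto intro: mult_nonpos_nonneg)
    qed
    have "l b < 0"
      using 0 b by auto
    then show "\<exists>b\<in>B. l b * (cmod (cinner b x))\<^sup>2 < 0"
      using b by (intro bexI[of _ b] mult_neg_pos) auto
  qed (rule finite_B)
  then show ?thesis
    by (simp add: quadratic_form)
qed

lemma quadratic_form_nonneg:
  assumes "x \<in> vec.span {b \<in> B. l b \<ge> 0}"
  shows "x \<bullet> (A *v x) \<ge> 0"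
proof -
  have "\<forall>b\<in>B - {b \<in> B. l b \<ge> 0}. cinner b x = 0"
    using assms(1) span_subset_iff[of "{b \<in> B. l b \<ge> 0}"] by auto
  then show ?thesis
    unfolding quadratic_form by (intro sum_nonneg) (metis (no_types, lifting) DiffI mem_Collect_eq
        mult_nonneg_nonneg mult_zero_right norm_zero order_refl zero_le_power2 zero_power2)
qed

lemma span_neg_plus_span_nonneg:
  "{x + y |x y. x \<in> vec.span {b \<in> B. l b < 0} \<and> y \<in> vec.span {b \<in> B. l b \<ge> 0}} = UNIV"
proof -
  have "{b \<in> B. l b < 0} \<union> {b \<in> B. l b \<ge> 0} = B"
    by auto
  then show ?thesis
    using vec.span_Un[of "{b \<in> B. l b < 0}" "{b \<in> B. l b \<ge> 0}"] by (simp add: span_B)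
qed

lemma uminus: "orthonormal_eigenbasis (- A) B (\<lambda>b. - l b)"
proof
  show "- A *v b = complex_of_real (- l b) *s b" if "b \<in> B" for b
    using eigen[OF that] by (simp add: uminus_matrix_mult)
qed (use orthonormal span_B hermitian_uminus[OF hermitian] in auto)

end

text \<open>A largest orthonormal set of eigenvectors must span: otherwise its orthogonal complement
  is nonzero and invariant, and so contains a further unit eigenvector.\<close>

lemma orthonormal_eigenbasis_exists:
  fixes A :: "complex^'n^'n"
  assumes A: "hermitian_matrix A"
  obtains B l where "orthonormal_eigenbasis A B l"
proof -
  \<comment> \<open>The eigenvalue of a unit eigenvector is its Rayleigh quotient, so one global
    \<open>l\<close> works for every set while \<open>B\<close> grows.\<close>
  define l where "l b = b \<bullet> (A *v b)" for b
  define Q where "Q B \<longleftrightarrow> cinner_orthonormal B \<and> (\<forall>b\<in>B. A *v b = complex_of_real (l b) *s b)" for B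
  have "Q {}"
    by (simp add: Q_def cinner_orthonormal_def)
  moreover have "\<forall>B. Q B \<longrightarrow> card B < Suc (DIM(complex^'n))"
    unfolding Q_def using cinner_orthonormal_dims(2) less_Suc_eq_le by blast
  ultimately obtain B where B: "Q B" and max: "\<And>C. Q C \<Longrightarrow> card C \<le> card B"
    using ex_has_greatest_nat[of Q "{}" card "Suc (DIM(complex^'n))"] by blast
  have on: "cinner_orthonormal B" and eig: "\<And>b. b \<in> B \<Longrightarrow> A *v b = complex_of_real (l b) *s b"
    using B by (auto simp: Q_def)
  have "vec.span B = UNIV"
  proof (rule ccontr)
    assume "vec.span B \<noteq> UNIV"
    then obtain y where y: "y \<noteq> 0" "\<And>v. v \<in> vec.span B \<Longrightarrow> cinner v y = 0"
      using ex_cinner_orthogonal[OF vec.subspace_span] by blast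
    define V where "V = {x. \<forall>b\<in>B. cinner b x = 0}"
    have "A *v x \<in> V" if "x \<in> V" for x
    proof -
      have "cinner b (A *v x) = 0" if b: "b \<in> B" for b
        using hermitian_cinner[OF A, of b x] eig[OF b] \<open>x \<in> V\<close> b by (simp add: cinner_simps V_def)
      then show ?thesis
        by (simp add: V_def)
    qed
    moreover have "y \<in> V"
      using y(2) by (auto simp: V_def intro: vec.span_base)
    ultimately obtain x where x: "x \<in> V" "norm x = 1" "A *v x = complex_of_real (l x) *s x"
      using hermitian_eigenvector_in_subspace[OF A, of V y] vec_subspace_cinner_eq_0[of B] y(1)
      unfolding V_def l_def by blast
    have bx: "cinner b x = 0" "cinner x b = 0" if "b \<in> B" for b
      using x(1) that cnj_cinner[of b x] by (auto simp: V_def)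
    have xx: "cinner x x = 1"
      using x(2) by (simp add: cinner_self)
    then have "x \<notin> B"
      using bx by auto
    have "Q (insert x B)"
      using on eig bx xx x(3) unfolding Q_def cinner_orthonormal_def by auto
    then have "card (insert x B) \<le> card B"
      by (rule max)
    then show False
      using \<open>x \<notin> B\<close> cinner_orthonormal_dims(1)[OF on] by simp
  qed
  then show ?thesis
    using that[of B l] on eig A by (simp add: orthonormal_eigenbasis_def)
qed

text \<open>What the dimension counts below need from the spectral theorem, freed of eigenvectors;
  the factors 2 are due to real dimensions.\<close>

definition sign_decomposition ::
  "complex^'n^'n \<Rightarrow> (complex^'n) set \<Rightarrow> (complex^'n) set \<Rightarrow> bool" where
  "sign_decomposition A N P \<longleftrightarrow> subspace N \<and> subspace P \<and>
     {x + y |x y. x \<in> N \<and> y \<in> P} = UNIV \<and>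
     (\<forall>x\<in>N. x \<noteq> 0 \<longrightarrow> x \<bullet> (A *v x) < 0) \<and> (\<forall>x\<in>P. x \<bullet> (A *v x) \<ge> 0) \<and>
     dim N = 2 * n_minus A \<and> dim P = 2 * CARD('n) - 2 * n_minus A"

lemma sign_decompositionD:
  fixes A :: "complex^'n^'n"
  assumes "sign_decomposition A N P"
  shows "subspace N" "subspace P" "{x + y |x y. x \<in> N \<and> y \<in> P} = UNIV"
    "\<And>x. x \<in> N \<Longrightarrow> x \<noteq> 0 \<Longrightarrow> x \<bullet> (A *v x) < 0" "\<And>x. x \<in> P \<Longrightarrow> x \<bullet> (A *v x) \<ge> 0"
    "dim N = 2 * n_minus A" "dim P = 2 * CARD('n) - 2 * n_minus A"
  using assms unfolding sign_decomposition_def by (simp_all only: bex_simps ball_simps) blast+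

lemma sign_decomposition_exists:
  fixes A :: "complex^'n^'n"
  assumes A: "hermitian_matrix A"
  obtains N P where "sign_decomposition A N P"
proof -
  obtain B l where "orthonormal_eigenbasis A B l"
    by (rule orthonormal_eigenbasis_exists[OF A])
  then interpret orthonormal_eigenbasis A B l .
  have "card {b \<in> B. l b < 0} + card {b \<in> B. l b \<ge> 0} = card ({b \<in> B. l b < 0} \<union> {b \<in> B. l b \<ge> 0})"
    using finite_B by (intro card_Un_disjoint[symmetric]) auto
  also have "{b \<in> B. l b < 0} \<union> {b \<in> B. l b \<ge> 0} = B"
    by auto
  finally have "dim (vec.span {b \<in> B. l b \<ge> 0}) = 2 * CARD('n) - 2 * n_minus A"
    by (simp add: dim_span_subset n_minus_eq_card card_B)
  then show ?thesis
    using quadratic_form_neg quadratic_form_nonneg span_neg_plus_span_nonneg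
    by (intro that[of "vec.span {b \<in> B. l b < 0}" "vec.span {b \<in> B. l b \<ge> 0}"])
      (simp add: sign_decomposition_def subspace_if_vec_subspace dim_span_subset n_minus_eq_card)
qed

text \<open>The same basis diagonalises \<open>- A\<close> with eigenvalues \<open>- l b\<close>, so
  splitting \<open>B\<close> by the sign of \<open>l\<close> counts the kernel and both negative
  indices at once.\<close>

lemma hermitian_inertia:
  fixes A :: "complex^'n^'n"
  assumes A: "hermitian_matrix A"
  shows "dim {x. A *v x = 0} + 2 * n_minus A + 2 * n_minus (- A) = 2 * CARD('n)"
proof -
  obtain B l where "orthonormal_eigenbasis A B l"
    by (rule orthonormal_eigenbasis_exists[OF A])
  then interpret orthonormal_eigenbasis A B l .
  interpret neg: orthonormal_eigenbasis "- A" B "\<lambda>b. - l b"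
    by (rule uminus)
  have "{x. A *v x = 0} = vec.span {b \<in> B. l b = 0}"
    using eigenspace_eq_span[of 0] by (simp add: eigenspace_def)
  then have "dim {x. A *v x = 0} = 2 * card {b \<in> B. l b = 0}"
    by (simp add: dim_span_subset)
  moreover have "card B = card {b \<in> B. l b = 0} + card {b \<in> B. l b < 0} + card {b \<in> B. - l b < 0}"
  proof -
    have "B = {b \<in> B. l b = 0} \<union> {b \<in> B. l b < 0} \<union> {b \<in> B. - l b < 0}"
      by auto
    also have "card \<dots> = card ({b \<in> B. l b = 0} \<union> {b \<in> B. l b < 0}) + card {b \<in> B. - l b < 0}"
      using finite_B by (intro card_Un_disjoint) auto
    also have "card ({b \<in> B. l b = 0} \<union> {b \<in> B. l b < 0}) =
        card {b \<in> B. l b = 0} + card {b \<in> B. l b < 0}"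
      using finite_B by (intro card_Un_disjoint) auto
    finally show ?thesis .
  qed
  ultimately show ?thesis
    by (simp add: n_minus_eq_card neg.n_minus_eq_card card_B)
qed

section \<open>Bounds for the negative index of a sum\<close>

lemma n_minus_le: "hermitian_matrix (A :: complex^'n^'n) \<Longrightarrow> n_minus A \<le> CARD('n)"
  using hermitian_inertia[of A] by linarith

text \<open>\<open>A + B\<close> is nonnegative on \<open>PA \<inter> PB\<close>, so
  \<open>N\<close> meets it only in 0, and its real codimension is at most
  \<open>2 * n_minus A + 2 * n_minus B\<close>.\<close>

lemma n_minus_add_le:
  fixes A B :: "complex^'n^'n"
  assumes A: "hermitian_matrix A" and B: "hermitian_matrix B" and AB: "hermitian_matrix (A + B)"
  shows "n_minus (A + B) \<le> n_minus A + n_minus B"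
proof -
  obtain NA PA where "sign_decomposition A NA PA"
    by (rule sign_decomposition_exists[OF A])
  note PA = sign_decompositionD[OF this]
  obtain NB PB where "sign_decomposition B NB PB"
    by (rule sign_decomposition_exists[OF B])
  note PB = sign_decompositionD[OF this]
  obtain N P where "sign_decomposition (A + B) N P"
    by (rule sign_decomposition_exists[OF AB])
  note N = sign_decompositionD[OF this]
  have "dim N + dim (PA \<inter> PB) \<le> dim (UNIV :: (complex^'n) set)"
  proof (rule dim_add_le_if_Int_trivial)
    show "N \<inter> (PA \<inter> PB) \<subseteq> {0}"
    proof
      fix x assume x: "x \<in> N \<inter> (PA \<inter> PB)"
      then have "x \<bullet> ((A + B) *v x) \<ge> 0"
        using PA(5)[of x] PB(5)[of x] by (simp add: matrix_vector_mult_add_rdistrib inner_add_right)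
      then show "x \<in> {0}"
        using N(4)[of x] x by force
    qed
  qed (simp_all add: N PA PB subspace_inter)
  moreover have "dim {x + y |x y. x \<in> PA \<and> y \<in> PB} + dim (PA \<inter> PB) = dim PA + dim PB"
    by (rule dim_sums_Int[OF PA(2) PB(2)])
  moreover have "dim {x + y |x y. x \<in> PA \<and> y \<in> PB} \<le> 2 * CARD('n)"
    using dim_subset_UNIV[of "{x + y |x y. x \<in> PA \<and> y \<in> PB}"] by simp
  moreover have "dim (UNIV :: (complex^'n) set) = 2 * CARD('n)"
    by simp
  ultimately show ?thesis
    using PA(7) PB(7) N(6) n_minus_le[OF A] n_minus_le[OF B] by linarith
qed

text \<open>The dual count: \<open>A + B\<close> is negative on the nonzero vectors of
  \<open>NA \<inter> NB\<close>, so this intersection meets \<open>P\<close> only in 0.\<close>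

lemma n_minus_add_ge:
  fixes A B :: "complex^'n^'n"
  assumes A: "hermitian_matrix A" and B: "hermitian_matrix B" and AB: "hermitian_matrix (A + B)"
  shows "n_minus A + n_minus B \<le> CARD('n) + n_minus (A + B)"
proof -
  obtain NA PA where "sign_decomposition A NA PA"
    by (rule sign_decomposition_exists[OF A])
  note NA = sign_decompositionD[OF this]
  obtain NB PB where "sign_decomposition B NB PB"
    by (rule sign_decomposition_exists[OF B])
  note NB = sign_decompositionD[OF this]
  obtain N P where "sign_decomposition (A + B) N P"
    by (rule sign_decomposition_exists[OF AB])
  note P = sign_decompositionD[OF this]
  have "dim P + dim (NA \<inter> NB) \<le> dim (UNIV :: (complex^'n) set)"
  proof (rule dim_add_le_if_Int_trivial)
    show "P \<inter> (NA \<inter> NB) \<subseteq> {0}"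
    proof
      fix x assume x: "x \<in> P \<inter> (NA \<inter> NB)"
      have "x \<bullet> ((A + B) *v x) < 0" if "x \<noteq> 0"
        using NA(4)[of x] NB(4)[of x] x that
        by (simp add: matrix_vector_mult_add_rdistrib inner_add_right)
      then show "x \<in> {0}"
        using P(5)[of x] x by force
    qed
  qed (simp_all add: P NA NB subspace_inter)
  moreover have "dim {x + y |x y. x \<in> NA \<and> y \<in> NB} + dim (NA \<inter> NB) = dim NA + dim NB"
    by (rule dim_sums_Int[OF NA(1) NB(1)])
  moreover have "dim {x + y |x y. x \<in> NA \<and> y \<in> NB} \<le> 2 * CARD('n)"
    using dim_subset_UNIV[of "{x + y |x y. x \<in> NA \<and> y \<in> NB}"] by simp
  moreover have "dim (UNIV :: (complex^'n) set) = 2 * CARD('n)"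
    by simp
  ultimately show ?thesis
    using NA(6) NB(6) P(7) n_minus_le[OF AB] by linarith
qed

section \<open>The Kashiwara form on triples of graphs\<close>

text \<open>For an orthogonal sum of forms, the product of the negative parts and the product of the
  nonnegative parts form a splitting. Strict negativity of one component suffices, as the others are
  at most 0.\<close>

lemma neg_index_sum3:
  fixes X Y Z :: "complex^'n^'n"
  assumes X: "hermitian_matrix X" and Y: "hermitian_matrix Y" and Z: "hermitian_matrix Z"
  shows "neg_index (\<lambda>(a, b, c). a \<bullet> (X *v a) + b \<bullet> (Y *v b) + c \<bullet> (Z *v c)) UNIV =
    2 * (n_minus X + n_minus Y + n_minus Z)"
proof -
  obtain NX PX where "sign_decomposition X NX PX"
    by (rule sign_decomposition_exists[OF X])
  note DX = sign_decompositionD[OF this]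
  obtain NY PY where "sign_decomposition Y NY PY"
    by (rule sign_decomposition_exists[OF Y])
  note DY = sign_decompositionD[OF this]
  obtain NZ PZ where "sign_decomposition Z NZ PZ"
    by (rule sign_decomposition_exists[OF Z])
  note DZ = sign_decompositionD[OF this]
  have le0: "x \<bullet> (M *v x) \<le> 0" if "x \<in> N" "\<And>x. x \<in> N \<Longrightarrow> x \<noteq> 0 \<Longrightarrow> x \<bullet> (M *v x) < 0"
    for x N and M :: "complex^'n^'n"
    using that(2)[OF that(1)] by (cases "x = 0") auto
  have "neg_index (\<lambda>(a, b, c). a \<bullet> (X *v a) + b \<bullet> (Y *v b) + c \<bullet> (Z *v c)) UNIV =
      dim (NX \<times> NY \<times> NZ)"
  proof (rule neg_index_eqI[where P = "PX \<times> PY \<times> PZ"])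
    show "subspace (NX \<times> NY \<times> NZ)" "subspace (PX \<times> PY \<times> PZ)"
      by (intro subspace_Times DX(1,2) DY(1,2) DZ(1,2))+
    have "p \<in> {x + y |x y. x \<in> NX \<times> NY \<times> NZ \<and> y \<in> PX \<times> PY \<times> PZ}"
      for p :: "(complex^'n) \<times> (complex^'n) \<times> (complex^'n)"
    proof -
      obtain a b c where p: "p = (a, b, c)"
        by (cases p)
      obtain a1 a2 where a: "a = a1 + a2" "a1 \<in> NX" "a2 \<in> PX"
        using DX(3) by blast
      obtain b1 b2 where b: "b = b1 + b2" "b1 \<in> NY" "b2 \<in> PY"
        using DY(3) by blast
      obtain c1 c2 where c: "c = c1 + c2" "c1 \<in> NZ" "c2 \<in> PZ"
        using DZ(3) by blast
      have "p = (a1, b1, c1) + (a2, b2, c2)"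
        by (simp add: p a b c)
      then show ?thesis
        using a b c by blast
    qed
    then show "UNIV = {x + y |x y. x \<in> NX \<times> NY \<times> NZ \<and> y \<in> PX \<times> PY \<times> PZ}"
      by blast
  next
    fix p assume p: "p \<in> NX \<times> NY \<times> NZ" "p \<noteq> 0"
    obtain a b c where abc: "p = (a, b, c)"
      by (cases p)
    have mem: "a \<in> NX" "b \<in> NY" "c \<in> NZ"
      using p abc by auto
    note le = le0[OF mem(1) DX(4)] le0[OF mem(2) DY(4)] le0[OF mem(3) DZ(4)]
    have "a \<noteq> 0 \<or> b \<noteq> 0 \<or> c \<noteq> 0"
      using p(2) abc by (simp add: zero_prod_def)
    then have "a \<bullet> (X *v a) < 0 \<or> b \<bullet> (Y *v b) < 0 \<or> c \<bullet> (Z *v c) < 0"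
      using DX(4)[OF mem(1)] DY(4)[OF mem(2)] DZ(4)[OF mem(3)] by blast
    then show "(case p of (a, b, c) \<Rightarrow> a \<bullet> (X *v a) + b \<bullet> (Y *v b) + c \<bullet> (Z *v c)) < 0"
      unfolding abc using le by auto
  next
    fix p assume "p \<in> PX \<times> PY \<times> PZ"
    then show "(case p of (a, b, c) \<Rightarrow> a \<bullet> (X *v a) + b \<bullet> (Y *v b) + c \<bullet> (Z *v c)) \<ge> 0"
      using DX(5) DY(5) DZ(5) by (auto intro!: add_nonneg_nonneg)
  qed
  also have "\<dots> = dim NX + (dim NY + dim NZ)"
    by (simp add: dim_Times subspace_Times DX(1) DY(1) DZ(1))
  finally show ?thesis
    using DX(6) DY(6) DZ(6) by simp
qed

text \<open>Half of \<Omega>(u; u): as \<open>omega\<close> is skew-Hermitian, each subtracted term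
  of \<Omega> adds the conjugate of one of the other three. The positive factor does not affect the
  negative index.\<close>

definition kashiwara_form ::
  "((complex^'n) \<times> (complex^'n)) \<times> ((complex^'n) \<times> (complex^'n)) \<times> ((complex^'n) \<times> (complex^'n)) \<Rightarrow> real"
  where "kashiwara_form = (\<lambda>(u, v, w). Re (omega u v + omega v w + omega w u))"

text \<open>The explicit formula of the paper, with real dimensions, which are twice the complex ones.\<close>

definition kashiwara_index ::
  "((complex^'n) \<times> (complex^'n)) set \<times> ((complex^'n) \<times> (complex^'n)) set \<times>
    ((complex^'n) \<times> (complex^'n)) set \<Rightarrow> nat" where
  "kashiwara_index = (\<lambda>(L1, L2, L3).
     (neg_index kashiwara_form (L1 \<times> L2 \<times> L3) + dim (L1 \<inter> L3)) div 2 - CARD('n))"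

lemma Re_omega: "Re (omega u v) = fst u \<bullet> snd v - snd u \<bullet> fst v"
  by (simp add: omega_def Re_cinner)

lemma matrix_diff_mult: "(A - B) *v x = A *v x - B *v (x :: complex^'n)"
  by (rule matrix_vector_mult_diff_rdistrib)

text \<open>The substitution diagonalises the form: for \<open>p + r + s = 0\<close>, the polynomial
  \<open>p x\<^sub>1 x\<^sub>2 + r x\<^sub>2 x\<^sub>3 + s x\<^sub>3 x\<^sub>1\<close> becomes \<open>p a\<^sup>2 + r b\<^sup>2 + s c\<^sup>2\<close> under
  \<open>x\<^sub>1 = a + c\<close>, \<open>x\<^sub>2 = a + b\<close>, \<open>x\<^sub>3 = b + c\<close>.\<close>

lemma neg_index_kashiwara_graphs:
  fixes A B C :: "complex^'n^'n"
  assumes A: "hermitian_matrix A" and B: "hermitian_matrix B" and C: "hermitian_matrix C"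
  shows "neg_index kashiwara_form (lagr_graph A \<times> lagr_graph B \<times> lagr_graph C) =
    2 * (n_minus (B - A) + n_minus (C - B) + n_minus (A - C))"
proof -
  define f where "f = (\<lambda>(a, b, c). ((a + c, A *v (a + c)), (a + b, B *v (a + b)), (b + c, C *v (b + c))))"
  have lin: "linear f"
    by (rule linearI)
      (auto simp: f_def matrix_vector_right_distrib complex_matrix_mult_scaleR scaleR_add_right)
  have "inj f"
  proof (rule injI)
    fix p q assume "f p = f q"
    moreover obtain a b c a' b' c' where pq: "p = (a, b, c)" "q = (a', b', c')"
      by (cases p, cases q)
    ultimately have eqs: "a + c = a' + c'" "a + b = a' + b'" "b + c = b' + c'"
      by (auto simp: f_def)
    have "2 *\<^sub>R a = (a + c) + (a + b) - (b + c)"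
      by (simp add: scaleR_2)
    also have "\<dots> = 2 *\<^sub>R a'"
      unfolding eqs by (simp add: scaleR_2)
    finally have "a = a'"
      by simp
    then show "p = q"
      using eqs pq by simp
  qed
  have ran: "range f = lagr_graph A \<times> lagr_graph B \<times> lagr_graph C"
  proof
    show "range f \<subseteq> lagr_graph A \<times> lagr_graph B \<times> lagr_graph C"
      by (auto simp: f_def lagr_graph_def)
    show "lagr_graph A \<times> lagr_graph B \<times> lagr_graph C \<subseteq> range f"
    proof
      fix p assume "p \<in> lagr_graph A \<times> lagr_graph B \<times> lagr_graph C"
      then obtain x y z where p: "p = ((x, A *v x), (y, B *v y), (z, C *v z))"
        by (auto simp: lagr_graph_def)
      have h: "(1/2) *\<^sub>R v + (1/2) *\<^sub>R v = v" for v :: "complex^'n"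
        by (metis field_sum_of_halves scaleR_add_left scaleR_one)
      \<comment> \<open>The solution of \<open>x = a + c\<close>, \<open>y = a + b\<close>,
        \<open>z = b + c\<close>.\<close>
      define a b c where "a = (1/2) *\<^sub>R (x + y - z)" and "b = (1/2) *\<^sub>R (y + z - x)"
        and "c = (1/2) *\<^sub>R (x + z - y)"
      have "a + c = (1/2) *\<^sub>R x + (1/2) *\<^sub>R x" "a + b = (1/2) *\<^sub>R y + (1/2) *\<^sub>R y"
        "b + c = (1/2) *\<^sub>R z + (1/2) *\<^sub>R z"
        by (simp_all add: a_def b_def c_def algebra_simps)
      then have "p = f (a, b, c)"
        by (simp add: p f_def h)
      then show "p \<in> range f"
        by blast
    qed
  qed
  have "kashiwara_form \<circ> f =
    (\<lambda>(a, b, c). a \<bullet> ((B - A) *v a) + b \<bullet> ((C - B) *v b) + c \<bullet> ((A - C) *v c))"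
  proof
    fix p :: "(complex^'n) \<times> (complex^'n) \<times> (complex^'n)"
    obtain a b c where p: "p = (a, b, c)"
      by (cases p)
    have sym: "(A *v x) \<bullet> y = x \<bullet> (A *v y)" "(B *v x) \<bullet> y = x \<bullet> (B *v y)"
        "(C *v x) \<bullet> y = x \<bullet> (C *v y)" for x y
      using hermitian_inner A B C by blast+
    have swap: "b \<bullet> (M *v a) = a \<bullet> (M *v b)" "c \<bullet> (M *v a) = a \<bullet> (M *v c)" "c \<bullet> (M *v b) = b \<bullet> (M *v c)"
      if "\<And>x y. (M *v x) \<bullet> y = x \<bullet> (M *v y)" for M :: "complex^'n^'n"
      using that by (metis inner_commute)+
    show "(kashiwara_form \<circ> f) p =
      (case p of (a, b, c) \<Rightarrow> a \<bullet> ((B - A) *v a) + b \<bullet> ((C - B) *v b) + c \<bullet> ((A - C) *v c))"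
      by (simp add: p f_def kashiwara_form_def Re_omega sym swap[of A] swap[of B] swap[of C] matrix_vector_right_distrib
          inner_add_left inner_add_right inner_diff_right matrix_diff_mult)
  qed
  then show ?thesis
    using neg_index_image[OF lin \<open>inj f\<close>, of kashiwara_form UNIV]
      neg_index_sum3[OF hermitian_diff[OF B A] hermitian_diff[OF C B] hermitian_diff[OF A C]]
    by (simp add: ran)
qed

section \<open>The form on a triple with the vertical plane\<close>

lemma hermitian_mat_1: "hermitian_matrix (mat 1)"
  by (simp add: hermitian_matrix_def mat_def)

lemma n_minus_mat_1: "n_minus (mat 1 :: complex^'n^'n) = 0"
proof -
  obtain N P where "sign_decomposition (mat 1 :: complex^'n^'n) N P"
    by (rule sign_decomposition_exists[OF hermitian_mat_1])
  note D = sign_decompositionD[OF this]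
  have "x = 0" if "x \<in> N" for x
  proof (rule ccontr)
    assume "x \<noteq> 0"
    then show False
      using D(4)[OF that] inner_ge_zero[of x] by simp
  qed
  then have "dim N = 0"
    by (auto simp: dim_eq_0)
  then show ?thesis
    using D(6) by simp
qed

lemma n_minus_uminus_mat_1: "n_minus (- mat 1 :: complex^'n^'n) = CARD('n)"
  using hermitian_inertia[OF hermitian_mat_1, where 'n = 'n] by (simp add: n_minus_mat_1)

text \<open>On \<open>(x, 0)\<close>, \<open>(y, A *v y)\<close>, \<open>(0, z)\<close> the form is
  \<open>y \<bullet> (A *v y) - (x - y) \<bullet> (z - A *v y)\<close>. Setting
  \<open>y = a\<close>, \<open>x - y = b + c\<close> and \<open>z - A *v y = c - b\<close> turns the
  hyperbolic term into \<open>b \<bullet> b - c \<bullet> c\<close>, whence the summand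
  \<open>CARD('n)\<close>.\<close>

lemma neg_index_kashiwara_inf:
  fixes A :: "complex^'n^'n"
  assumes A: "hermitian_matrix A"
  shows "neg_index kashiwara_form (lagr_graph 0 \<times> lagr_graph A \<times> lagr_graph_inf) =
    2 * (n_minus A + CARD('n))"
proof -
  define f where "f = (\<lambda>(a, b, c). ((a + (b + c), 0 :: complex^'n), (a, A *v a), (0 :: complex^'n, c - b + A *v a)))"
  have lin: "linear f"
    by (rule linearI) (auto simp: f_def matrix_vector_right_distrib complex_matrix_mult_scaleR algebra_simps)
  have "inj f"
  proof (rule injI)
    fix p q assume "f p = f q"
    moreover obtain a b c a' b' c' where pq: "p = (a, b, c)" "q = (a', b', c')"
      by (cases p, cases q)
    ultimately have eqs: "a = a'" "b + c = b' + c'" "c - b = c' - b'"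
      by (auto simp: f_def)
    have "2 *\<^sub>R b = (b + c) - (c - b)"
      by (simp add: scaleR_2)
    also have "\<dots> = 2 *\<^sub>R b'"
      unfolding eqs by (simp add: scaleR_2)
    finally have "b = b'"
      by simp
    then show "p = q"
      using eqs pq by simp
  qed
  have ran: "range f = lagr_graph 0 \<times> lagr_graph A \<times> lagr_graph_inf"
  proof
    show "range f \<subseteq> lagr_graph 0 \<times> lagr_graph A \<times> lagr_graph_inf"
      by (auto simp: f_def lagr_graph_def lagr_graph_inf_def)
    show "lagr_graph 0 \<times> lagr_graph A \<times> lagr_graph_inf \<subseteq> range f"
    proof
      fix p :: "((complex^'n) \<times> (complex^'n)) \<times> ((complex^'n) \<times> (complex^'n)) \<times> ((complex^'n) \<times> (complex^'n))"
      assume "p \<in> lagr_graph 0 \<times> lagr_graph A \<times> lagr_graph_inf"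
      then obtain x y z where p: "p = ((x, 0), (y, A *v y), (0, z))"
        by (auto simp: lagr_graph_def lagr_graph_inf_def)
      have h: "(1/2) *\<^sub>R v + (1/2) *\<^sub>R v = v" for v :: "complex^'n"
        by (metis field_sum_of_halves scaleR_add_left scaleR_one)
      define b c where "b = (1/2) *\<^sub>R ((x - y) - (z - A *v y))"
        and "c = (1/2) *\<^sub>R ((x - y) + (z - A *v y))"
      have "b + c = (1/2) *\<^sub>R (x - y) + (1/2) *\<^sub>R (x - y)"
        "c - b = (1/2) *\<^sub>R (z - A *v y) + (1/2) *\<^sub>R (z - A *v y)"
        by (simp_all add: b_def c_def algebra_simps)
      then have "b + c = x - y" "c - b = z - A *v y"
        by (simp_all only: h)
      then have "p = f (y, b, c)"
        by (simp add: p f_def)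
      then show "p \<in> range f"
        by blast
    qed
  qed
  have "kashiwara_form \<circ> f =
    (\<lambda>(a, b, c). a \<bullet> (A *v a) + b \<bullet> (mat 1 *v b) + c \<bullet> ((- mat 1) *v c))"
  proof
    fix p :: "(complex^'n) \<times> (complex^'n) \<times> (complex^'n)"
    obtain a b c where p: "p = (a, b, c)"
      by (cases p)
    show "(kashiwara_form \<circ> f) p =
      (case p of (a, b, c) \<Rightarrow> a \<bullet> (A *v a) + b \<bullet> (mat 1 *v b) + c \<bullet> ((- mat 1) *v c))"
      by (simp add: p f_def kashiwara_form_def Re_omega uminus_matrix_mult
          inner_commute[of "A *v a" a] inner_commute[of "A *v a" b] inner_commute[of "A *v a" c]
          inner_commute[of b a] inner_commute[of c a] inner_commute[of c b]
          inner_add_left inner_add_right inner_diff_left inner_diff_right)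
  qed
  then show ?thesis
    using neg_index_image[OF lin \<open>inj f\<close>, of kashiwara_form UNIV]
      neg_index_sum3[OF A hermitian_mat_1 hermitian_uminus[OF hermitian_mat_1]]
    by (simp add: ran n_minus_mat_1 n_minus_uminus_mat_1)
qed

section \<open>Symplectic maps and Lagrangian planes\<close>

lemma omega_nondegenerate:
  assumes "\<And>v. omega u v = 0"
  shows "u = 0"
proof -
  \<comment> \<open>The test vector is the image of \<open>u\<close> under the standard complex
    structure, which turns \<open>omega\<close> into the squared norm.\<close>
  have "omega u (- snd u, fst u) = cinner (fst u) (fst u) + cinner (snd u) (snd u)"
    by (simp add: omega_def cinner_simps)
  also have "\<dots> = complex_of_real ((norm (fst u))\<^sup>2 + (norm (snd u))\<^sup>2)"
    by (simp add: cinner_self)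
  finally have "(norm (fst u))\<^sup>2 + (norm (snd u))\<^sup>2 = 0"
    using assms by (metis of_real_eq_0_iff)
  then show ?thesis
    by (simp add: sum_power2_eq_zero_iff prod_eq_iff)
qed

lemma scaleR_eq_sympl_scale: "r *\<^sub>R u = sympl.scale (complex_of_real r) u"
  by (simp add: sympl.scale_def prod_eq_iff scaleR_eq_vector_scalar_mult)

context
  fixes S :: "(complex^'n) \<times> (complex^'n) \<Rightarrow> (complex^'n) \<times> (complex^'n)"
  assumes S: "symplectic S"
begin

lemma symplectic_add: "S (u + v) = S u + S v"
  and symplectic_scale: "S (sympl.scale c u) = sympl.scale c (S u)"
  and symplectic_omega: "omega (S u) (S v) = omega u v"
  using S unfolding symplectic_def Vector_Spaces.linear_iff by blast+

lemma symplectic_linear: "linear S"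
  by (rule linearI) (simp_all add: symplectic_add symplectic_scale scaleR_eq_sympl_scale)

text \<open>A vector killed by \<open>S\<close> pairs to 0 with everything, since
  \<open>omega\<close> is preserved, so nondegeneracy applies.\<close>

lemma symplectic_inj: "inj S"
proof -
  have "u = 0" if "S u = 0" for u
  proof (rule omega_nondegenerate)
    show "omega u v = 0" for v
      using symplectic_omega[of u v] that by (simp add: omega_def cinner_simps)
  qed
  then show ?thesis
    using linear_injective_0[OF symplectic_linear] by blast
qed

lemma symplectic_surj: "surj S"
  by (rule linear_injective_imp_surjective[OF symplectic_linear symplectic_inj refl])

lemma symplectic_Lagrangian:
  assumes "L \<in> Lagrangian"
  shows "S ` L \<in> Lagrangian"
proof -
  have sub: "sympl.p.subspace L" and eq: "L = {v. \<forall>u\<in>L. omega u v = 0}"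
    using assms by (auto simp: Lagrangian_def)
  have "0 \<in> L"
    using sub by (simp add: sympl.p.subspace_def)
  then have "0 \<in> S ` L"
    using linear_0[OF symplectic_linear] by force
  then have "sympl.p.subspace (S ` L)"
    using sub by (auto simp: sympl.p.subspace_def simp flip: symplectic_add symplectic_scale)
  moreover have "S ` L = {v. \<forall>u\<in>S ` L. omega u v = 0}"
  proof (intro set_eqI)
    fix v
    obtain w where w: "v = S w"
      using symplectic_surj by (metis surjD)
    have "v \<in> S ` L \<longleftrightarrow> w \<in> L"
      using inj_image_mem_iff[OF symplectic_inj] w by auto
    also have "\<dots> \<longleftrightarrow> (\<forall>u\<in>L. omega u w = 0)"
      using eq by blast
    finally show "v \<in> S ` L \<longleftrightarrow> v \<in> {v. \<forall>u\<in>S ` L. omega u v = 0}"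
      by (simp add: w symplectic_omega)
  qed
  ultimately show ?thesis
    unfolding Lagrangian_def by blast
qed

end

section \<open>Graphs, the vertical plane and elementary symplectic maps\<close>

lemma lagr_graph_Lagrangian:
  assumes M: "hermitian_matrix M"
  shows "lagr_graph M \<in> Lagrangian"
proof -
  have "(x, y) \<in> lagr_graph M \<longleftrightarrow> (x, y) \<in> {v. \<forall>u\<in>lagr_graph M. omega u v = 0}" for x y
  proof -
    have om: "omega (z, M *v z) (x, y) = cinner z (y - M *v x)" for z
      by (simp add: omega_def cinner_simps hermitian_cinner[OF M])
    have "(\<forall>z. cinner z (y - M *v x) = 0) \<longleftrightarrow> y = M *v x"
      by (metis cinner_self_eq_0 cinner_zero_right eq_iff_diff_eq_0)
    then show ?thesis
      by (auto simp: lagr_graph_def om)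
  qed
  moreover have "sympl.p.subspace (lagr_graph M)"
    by (auto simp: sympl.p.subspace_def lagr_graph_def sympl.scale_def zero_prod_def
        matrix_vector_right_distrib vec.scale)
  ultimately show ?thesis
    unfolding Lagrangian_def by auto
qed

lemma lagr_graph_inf_Lagrangian: "lagr_graph_inf \<in> Lagrangian"
proof -
  have "(x, y) \<in> lagr_graph_inf \<longleftrightarrow> (x, y) \<in> {v. \<forall>u\<in>lagr_graph_inf. omega u v = 0}"
    for x y :: "complex^'n"
  proof -
    have "(\<forall>z. cinner z x = 0) \<longleftrightarrow> x = 0"
      by (metis cinner_self_eq_0 cinner_zero_right)
    then show ?thesis
      by (auto simp: lagr_graph_inf_def omega_def cinner_simps)
  qed
  moreover have "sympl.p.subspace (lagr_graph_inf :: ((complex^'n) \<times> (complex^'n)) set)"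
    by (auto simp: sympl.p.subspace_def lagr_graph_inf_def sympl.scale_def zero_prod_def)
  ultimately show ?thesis
    unfolding Lagrangian_def by auto
qed

lemma symplecticI:
  assumes "\<And>u v. S (u + v) = S u + S v" "\<And>c u. S (sympl.scale c u) = sympl.scale c (S u)"
    and "\<And>u v. omega (S u) (S v) = omega u v"
  shows "symplectic S"
  unfolding symplectic_def Vector_Spaces.linear_iff
  using assms sympl.p.vector_space_axioms by blast

lemma symplectic_shear:
  assumes M: "hermitian_matrix M"
  shows "symplectic (\<lambda>(x, y). (x, y + M *v x))"
proof (rule symplecticI; clarify)
  show "omega (a, b + M *v a) (a', b' + M *v a') = omega (a, b) (a', b')" for a b a' b'
    by (simp add: omega_def cinner_simps hermitian_cinner[OF M])
qed (simp_all add: sympl.scale_def vec.scale matrix_vector_right_distrib vec.scale_right_distrib)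

text \<open>The shear by \<open>- t\<close> followed by a quarter turn. It maps exactly the vectors
  \<open>(x, t x)\<close> into the vertical plane, so the image of \<open>L\<close> meets that plane
  nontrivially only if \<open>L\<close> contains such a vector with
  \<open>x \<noteq> 0\<close>.\<close>

lemma symplectic_rotation:
  "symplectic (\<lambda>(x, y). (y - complex_of_real t *s x, - x))"
proof (rule symplecticI; clarify)
  show "omega (b - complex_of_real t *s a, - a) (b' - complex_of_real t *s a', - a') =
      omega (a, b) (a', b')" for a b a' b' :: "complex^'n"
    by (simp add: omega_def cinner_simps)
qed (simp_all add: sympl.scale_def vec.scale_right_distrib vec.scale_right_diff_distrib mult.commute)

lemma shear_graph: "(\<lambda>(x, y). (x, y + M *v x)) ` lagr_graph A = lagr_graph (A + M)"
  by (auto simp: lagr_graph_def image_def matrix_vector_mult_add_rdistrib)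

lemma shear_graph_inf: "(\<lambda>(x, y). (x, y + M *v x)) ` lagr_graph_inf = lagr_graph_inf"
  by (auto simp: lagr_graph_inf_def image_def)

text \<open>Isotropy makes vectors \<open>x\<close> with \<open>(x, t x) \<in> L\<close> orthogonal for different real \<open>t\<close>.\<close>

lemma finite_slopes:
  assumes L: "L \<in> Lagrangian"
  shows "finite {t. \<exists>x. x \<noteq> 0 \<and> (x, complex_of_real t *s x) \<in> L}" (is "finite ?T")
proof -
  have "\<forall>t\<in>?T. \<exists>x. x \<noteq> 0 \<and> (x, complex_of_real t *s x) \<in> L"
    by blast
  then obtain f where f: "\<forall>t\<in>?T. f t \<noteq> 0 \<and> (f t, complex_of_real t *s f t) \<in> L"
    by (rule bchoice[THEN exE])
  have orth: "f s \<bullet> f t = 0" if "s \<in> ?T" "t \<in> ?T" "s \<noteq> t" for s t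
  proof -
    have "omega (f s, complex_of_real s *s f s) (f t, complex_of_real t *s f t) = 0"
      using f that L unfolding Lagrangian_def by blast
    then have "(complex_of_real t - complex_of_real s) * cinner (f s) (f t) = 0"
      by (simp add: omega_def cinner_simps algebra_simps)
    then show ?thesis
      using that(3) by (simp flip: Re_cinner)
  qed
  have "pairwise orthogonal (f ` ?T)"
    using orth by (auto simp: pairwise_def orthogonal_def)
  then have "finite (f ` ?T)"
    by (rule pairwise_orthogonal_imp_finite)
  \<comment> \<open>A vector chosen for two different slopes would be orthogonal to itself, yet it
    is nonzero.\<close>
  moreover have "inj_on f ?T"
    using orth f by (metis (no_types, lifting) inj_onI inner_eq_zero_iff)
  ultimately show ?thesis
    by (rule finite_imageD)
qed

text \<open>Each half of the Lagrangian condition is used: maximality makes the first projection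
  onto, because a vector \<open>y\<close> orthogonal to it would put \<open>(0, y)\<close> into
  \<open>L\<close>, and isotropy makes the resulting linear map Hermitian. The hypothesis
  \<open>inf\<close> makes it single-valued.\<close>

lemma Lagrangian_eq_graph:
  fixes L :: "((complex^'n) \<times> (complex^'n)) set"
  assumes L: "L \<in> Lagrangian" and inf: "\<And>y. (0, y) \<in> L \<Longrightarrow> y = 0"
  obtains M where "hermitian_matrix M" "L = lagr_graph M"
proof -
  have sub: "sympl.p.subspace L" and eq: "L = {v. \<forall>u\<in>L. omega u v = 0}"
    using L by (auto simp: Lagrangian_def)
  have add: "(x + x', y + y') \<in> L" if "(x, y) \<in> L" "(x', y') \<in> L" for x y x' y'
    using sympl.p.subspace_add[OF sub that] by simp
  have scale: "(c *s x, c *s y) \<in> L" if "(x, y) \<in> L" for c x y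
    using sympl.p.subspace_scale[OF sub that] by (simp add: sympl.scale_prod)
  have uniq: "y = z" if "(x, y) \<in> L" "(x, z) \<in> L" for x y z
    using inf[of "y - z"] sympl.p.subspace_diff[OF sub that] by simp
  have zero: "(0, 0) \<in> L"
    using sympl.p.subspace_0[OF sub] by (simp add: zero_prod_def)
  have "fst ` L = UNIV"
  proof (rule ccontr)
    assume ne: "fst ` L \<noteq> UNIV"
    have "vec.subspace (fst ` L)"
    proof (rule vec.subspaceI)
      show "0 \<in> fst ` L"
        using zero by force
      show "x + y \<in> fst ` L" if xy: "x \<in> fst ` L" "y \<in> fst ` L" for x y
      proof -
        obtain x' y' where "(x, x') \<in> L" "(y, y') \<in> L"
          using xy by auto
        then show ?thesis
          using add by force
      qed
      show "c *s x \<in> fst ` L" if x: "x \<in> fst ` L" for c x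
      proof -
        obtain x' where "(x, x') \<in> L"
          using x by auto
        then show ?thesis
          using scale by force
      qed
    qed
    then obtain y where y: "y \<noteq> 0" "\<And>v. v \<in> fst ` L \<Longrightarrow> cinner v y = 0"
      using ex_cinner_orthogonal[OF _ ne] by blast
    then have "\<forall>u\<in>L. omega u (0, y) = 0"
      by (simp add: omega_def cinner_simps)
    then have "(0, y) \<in> L"
      using eq by blast
    then show False
      using inf y(1) by blast
  qed
  then have "\<forall>x. \<exists>y. (x, y) \<in> L"
    by (metis UNIV_I imageE prod.collapse)
  then obtain g where g: "\<And>x. (x, g x) \<in> L"
    by metis
  have "Vector_Spaces.linear (*s) (*s) g"
    unfolding Vector_Spaces.linear_iff
    using uniq[OF g add[OF g g]] uniq[OF g scale[OF g]] by (auto intro: vec.vector_space_axioms)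
  then have mat: "matrix g *v x = g x" for x
    by (rule matrix_works)
  have "cinner (g x) y = cinner x (g y)" for x y
  proof -
    have "omega (x, g x) (y, g y) = 0"
      using g eq by blast
    then show ?thesis
      by (simp add: omega_def)
  qed
  then have "hermitian_matrix (matrix g)"
    by (intro hermitian_if_cinner) (simp add: mat)
  moreover have "L = lagr_graph (matrix g)"
    using g uniq by (auto simp: lagr_graph_def mat)
  ultimately show ?thesis
    by (rule that)
qed

lemma simultaneous_graphs:
  fixes F :: "((complex^'n) \<times> (complex^'n)) set set"
  assumes fin: "finite F" and F: "F \<subseteq> Lagrangian"
  obtains S where "symplectic S" "\<forall>L\<in>F. \<exists>M. hermitian_matrix M \<and> S ` L = lagr_graph M"
proof -
  have "finite (\<Union>L\<in>F. {t. \<exists>x. x \<noteq> 0 \<and> (x, complex_of_real t *s x) \<in> L})"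
    using fin F finite_slopes by blast
  then obtain t where t: "t \<notin> (\<Union>L\<in>F. {t. \<exists>x. x \<noteq> 0 \<and> (x, complex_of_real t *s x) \<in> L})"
    using ex_new_if_finite[OF infinite_UNIV_char_0] by blast
  define S :: "(complex^'n) \<times> (complex^'n) \<Rightarrow> (complex^'n) \<times> (complex^'n)"
    where "S = (\<lambda>(x, y). (y - complex_of_real t *s x, - x))"
  have S: "symplectic S"
    unfolding S_def by (rule symplectic_rotation)
  show ?thesis
  proof (rule that[OF S], rule ballI)
    fix L assume L: "L \<in> F"
    have "y = 0" if y: "(0, y) \<in> S ` L" for y
    proof -
      obtain x where "(x, complex_of_real t *s x) \<in> L" "y = - x"
        using y by (auto simp: S_def)
      then show ?thesis
        using t L by auto
    qed
    moreover have "S ` L \<in> Lagrangian"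
      using symplectic_Lagrangian[OF S] F L by blast
    ultimately show "\<exists>M. hermitian_matrix M \<and> S ` L = lagr_graph M"
      using Lagrangian_eq_graph by metis
  qed
qed

section \<open>The Duistermaat index\<close>

lemma dim_graph_Int:
  fixes A C :: "complex^'n^'n"
  shows "dim (lagr_graph A \<inter> lagr_graph C) = dim {x. (C - A) *v x = 0}"
proof -
  have "linear (\<lambda>x. (x, A *v x))"
    by (rule linearI) (simp_all add: matrix_vector_right_distrib complex_matrix_mult_scaleR)
  moreover have "inj_on (\<lambda>x. (x, A *v x)) (span {x. (C - A) *v x = 0})"
    by (simp add: inj_on_def)
  ultimately have "dim ((\<lambda>x. (x, A *v x)) ` {x. (C - A) *v x = 0}) = dim {x. (C - A) *v x = 0}"
    by (rule dim_image_eq)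
  moreover have "(\<lambda>x. (x, A *v x)) ` {x. (C - A) *v x = 0} = lagr_graph A \<inter> lagr_graph C"
    by (auto simp: lagr_graph_def matrix_diff_mult image_def)
  ultimately show ?thesis
    by simp
qed

text \<open>The first bound makes the truncated subtraction in \<open>kashiwara_index\<close> exact
  on graphs; the second keeps the index at most \<open>CARD('n)\<close>.\<close>

lemma n_minus_diff_triangle:
  fixes A B C :: "complex^'n^'n"
  assumes "hermitian_matrix A" "hermitian_matrix B" "hermitian_matrix C"
  shows "n_minus (C - A) \<le> n_minus (B - A) + n_minus (C - B)"
    "n_minus (B - A) + n_minus (C - B) \<le> CARD('n) + n_minus (C - A)"
proof -
  have "(B - A) + (C - B) = C - A"
    by simp
  then show "n_minus (C - A) \<le> n_minus (B - A) + n_minus (C - B)"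
    "n_minus (B - A) + n_minus (C - B) \<le> CARD('n) + n_minus (C - A)"
    using n_minus_add_le[of "B - A" "C - B"] n_minus_add_ge[of "B - A" "C - B"]
      hermitian_diff[of B A] hermitian_diff[of C B] hermitian_diff[of C A] assms by metis+
qed

lemma kashiwara_index_graphs:
  fixes A B C :: "complex^'n^'n"
  assumes A: "hermitian_matrix A" and B: "hermitian_matrix B" and C: "hermitian_matrix C"
  shows "int (kashiwara_index (lagr_graph A, lagr_graph B, lagr_graph C)) =
    int (n_minus (B - A)) - int (n_minus (C - A)) + int (n_minus (C - B))"
proof -
  have "dim {x. (C - A) *v x = 0} + 2 * n_minus (C - A) + 2 * n_minus (A - C) = 2 * CARD('n)"
    using hermitian_inertia[OF hermitian_diff[OF C A]] by simp
  moreover have "n_minus (C - A) \<le> n_minus (B - A) + n_minus (C - B)"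
    by (rule n_minus_diff_triangle[OF A B C])
  \<comment> \<open>Here \<open>a\<close>, \<open>b\<close>, \<open>c\<close>, \<open>d\<close>
    stand for the negative indices of \<open>B - A\<close>, \<open>C - B\<close>,
    \<open>C - A\<close>, \<open>A - C\<close>, and \<open>k\<close> for the real dimension of the
    kernel of \<open>C - A\<close>. The hypothesis \<open>le\<close> keeps both the halving and the
    subtraction of \<open>n\<close> exact, with result \<open>e = a + b - c\<close>.\<close>
  moreover have "int ((2 * (a + b + d) + k) div 2 - n) = int a - int c + int b"
    if eq: "k + 2 * c + 2 * d = 2 * n" and le: "c \<le> a + b" for a b c d k n :: nat
  proof -
    obtain e where e: "a + b = c + e"
      using le le_Suc_ex by blast
    have double: "2 * (a + b + d) + k = 2 * (e + n)"
      using eq e by presburger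
    have "(2 * (a + b + d) + k) div 2 - n = e"
      unfolding double by simp
    then show ?thesis
      using e by linarith
  qed
  ultimately show ?thesis
    unfolding kashiwara_index_def prod.case neg_index_kashiwara_graphs[OF A B C] dim_graph_Int
    by blast
qed

lemma kashiwara_index_inf:
  fixes A :: "complex^'n^'n"
  assumes A: "hermitian_matrix A"
  shows "kashiwara_index (lagr_graph 0, lagr_graph A, lagr_graph_inf) = n_minus A"
proof -
  have "lagr_graph 0 \<inter> lagr_graph_inf = {0 :: (complex^'n) \<times> (complex^'n)}"
    by (auto simp: lagr_graph_def lagr_graph_inf_def zero_prod_def)
  then have "dim (lagr_graph 0 \<inter> lagr_graph_inf :: ((complex^'n) \<times> (complex^'n)) set) = 0"
    by simp
  then show ?thesis
    unfolding kashiwara_index_def prod.case neg_index_kashiwara_inf[OF A] by presburger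
qed

lemma kashiwara_index_symplectic:
  fixes S :: "(complex^'n) \<times> (complex^'n) \<Rightarrow> (complex^'n) \<times> (complex^'n)"
  assumes S: "symplectic S"
  shows "kashiwara_index (S ` L1, S ` L2, S ` L3) = kashiwara_index (L1, L2, L3)"
proof -
  define f where "f = (\<lambda>(u, v, w). (S u, S v, S w))"
  have lin: "linear f"
    using symplectic_linear[OF S] by (intro linearI)
      (simp_all only: f_def case_prod_unfold fst_add snd_add fst_scaleR snd_scaleR linear_add
        linear_scale add_Pair scaleR_Pair)
  have "inj f"
    using symplectic_inj[OF S] by (auto simp: f_def inj_def)
  have "f ` (L1 \<times> L2 \<times> L3) = S ` L1 \<times> S ` L2 \<times> S ` L3"
    unfolding f_def by force
  moreover have "kashiwara_form \<circ> f = kashiwara_form"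
    by (auto simp: fun_eq_iff kashiwara_form_def f_def symplectic_omega[OF S])
  ultimately have "neg_index kashiwara_form (S ` L1 \<times> S ` L2 \<times> S ` L3) =
      neg_index kashiwara_form (L1 \<times> L2 \<times> L3)"
    using neg_index_image[OF lin \<open>inj f\<close>, of kashiwara_form "L1 \<times> L2 \<times> L3"] by simp
  moreover have "dim (S ` L1 \<inter> S ` L3) = dim (L1 \<inter> L3)"
    using dim_image_eq[OF symplectic_linear[OF S] inj_on_subset[OF symplectic_inj[OF S] subset_UNIV]]
    by (simp add: image_Int[OF symplectic_inj[OF S], symmetric])
  ultimately show ?thesis
    by (simp add: kashiwara_index_def)
qed

text \<open>Four planes are what the cocycle identity involves; arguments about triples pass the
  last plane twice.\<close>

lemma four_Lagrangians_graphs: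
  fixes L1 L2 L3 L4 :: "((complex^'n) \<times> (complex^'n)) set"
  assumes L: "L1 \<in> Lagrangian" "L2 \<in> Lagrangian" "L3 \<in> Lagrangian" "L4 \<in> Lagrangian"
  obtains S A B C D where "symplectic S" "hermitian_matrix A" "hermitian_matrix B"
    "hermitian_matrix C" "hermitian_matrix D" "S ` L1 = lagr_graph A" "S ` L2 = lagr_graph B"
    "S ` L3 = lagr_graph C" "S ` L4 = lagr_graph D"
proof -
  have "finite {L1, L2, L3, L4}" "{L1, L2, L3, L4} \<subseteq> Lagrangian"
    using L by auto
  then obtain S where S: "symplectic S"
    and gr: "\<forall>L\<in>{L1, L2, L3, L4}. \<exists>M. hermitian_matrix M \<and> S ` L = lagr_graph M"
    by (rule simultaneous_graphs)
  obtain A where "hermitian_matrix A" "S ` L1 = lagr_graph A"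
    using gr by auto
  moreover obtain B where "hermitian_matrix B" "S ` L2 = lagr_graph B"
    using gr by auto
  moreover obtain C where "hermitian_matrix C" "S ` L3 = lagr_graph C"
    using gr by auto
  moreover obtain D where "hermitian_matrix D" "S ` L4 = lagr_graph D"
    using gr by auto
  ultimately show ?thesis
    using that[OF S] by simp
qed

lemma is_duistermaat_index_kashiwara_index:
  "is_duistermaat_index (restrict kashiwara_index
     (Lagrangian \<times> Lagrangian \<times> (Lagrangian :: ((complex^'n) \<times> (complex^'n)) set set)))"
proof -
  have range: "kashiwara_index (L1, L2, L3) \<le> CARD('n)"
    if L: "L1 \<in> Lagrangian" "L2 \<in> Lagrangian" "L3 \<in> Lagrangian"
    for L1 L2 L3 :: "((complex^'n) \<times> (complex^'n)) set"
  proof -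
    obtain S A B C D where *: "symplectic S" "hermitian_matrix A" "hermitian_matrix B"
        "hermitian_matrix C" "hermitian_matrix D" "S ` L1 = lagr_graph A" "S ` L2 = lagr_graph B"
        "S ` L3 = lagr_graph C" "S ` L3 = lagr_graph D"
      by (rule four_Lagrangians_graphs[OF L L(3)])
    then show ?thesis
      using kashiwara_index_symplectic[OF *(1), of L1 L2 L3] kashiwara_index_graphs[OF *(2-4)]
        n_minus_diff_triangle(2)[OF *(2-4)] by simp
  qed
  have cocycle: "int (kashiwara_index (L1, L2, L3)) - int (kashiwara_index (L1, L2, L4)) +
      int (kashiwara_index (L1, L3, L4)) - int (kashiwara_index (L2, L3, L4)) = 0"
    if L: "L1 \<in> Lagrangian" "L2 \<in> Lagrangian" "L3 \<in> Lagrangian" "L4 \<in> Lagrangian"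
    for L1 L2 L3 L4 :: "((complex^'n) \<times> (complex^'n)) set"
  proof -
    obtain S A B C D where *: "symplectic S" "hermitian_matrix A" "hermitian_matrix B"
        "hermitian_matrix C" "hermitian_matrix D" "S ` L1 = lagr_graph A" "S ` L2 = lagr_graph B"
        "S ` L3 = lagr_graph C" "S ` L4 = lagr_graph D"
      by (rule four_Lagrangians_graphs[OF L])
    \<comment> \<open>Once all four planes are graphs, each \<open>n_minus\<close> of a difference
      occurs twice with opposite signs.\<close>
    show ?thesis
      unfolding kashiwara_index_symplectic[OF *(1), symmetric, of L1]
        kashiwara_index_symplectic[OF *(1), symmetric, of L2] *(6-9)
      by (simp add: kashiwara_index_graphs *(2-5))
  qed
  have "hermitian_matrix (0 :: complex^'n^'n)"
    by (simp add: hermitian_matrix_def)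
  then show ?thesis
    unfolding is_duistermaat_index_def
    using range cocycle kashiwara_index_symplectic kashiwara_index_inf
    by (auto simp: lagr_graph_Lagrangian lagr_graph_inf_Lagrangian symplectic_Lagrangian)
qed

lemma is_duistermaat_indexD:
  fixes i :: "((complex^'n) \<times> (complex^'n)) set \<times> ((complex^'n) \<times> (complex^'n)) set \<times>
    ((complex^'n) \<times> (complex^'n)) set \<Rightarrow> nat"
  assumes "is_duistermaat_index i"
  shows "i \<in> (Lagrangian \<times> Lagrangian \<times> Lagrangian) \<rightarrow>\<^sub>E {0..CARD('n)}"
    and "hermitian_matrix A \<Longrightarrow> i (lagr_graph 0, lagr_graph A, lagr_graph_inf) = n_minus A"
    and "symplectic S \<Longrightarrow> L1 \<in> Lagrangian \<Longrightarrow> L2 \<in> Lagrangian \<Longrightarrow> L3 \<in> Lagrangian \<Longrightarrow>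
      i (S ` L1, S ` L2, S ` L3) = i (L1, L2, L3)"
    and "L1 \<in> Lagrangian \<Longrightarrow> L2 \<in> Lagrangian \<Longrightarrow> L3 \<in> Lagrangian \<Longrightarrow> L4 \<in> Lagrangian \<Longrightarrow>
      int (i (L1, L2, L3)) - int (i (L1, L2, L4)) + int (i (L1, L3, L4)) - int (i (L2, L3, L4)) = 0"
  using assms unfolding is_duistermaat_index_def by blast+

text \<open>Stated for an arbitrary function with the defining properties, since it is applied both
  to compare two indices and, at the end, to \<open>duistermaat_index\<close> itself.\<close>

lemma is_duistermaat_index_graphs:
  fixes A B C :: "complex^'n^'n"
  assumes i: "is_duistermaat_index i"
    and A: "hermitian_matrix A" and B: "hermitian_matrix B" and C: "hermitian_matrix C"
  shows "int (i (lagr_graph A, lagr_graph B, lagr_graph C)) =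
    int (n_minus (B - A)) - int (n_minus (C - A)) + int (n_minus (C - B))"
proof -
  have shear: "i (lagr_graph M, lagr_graph M', lagr_graph_inf) = n_minus (M' - M)"
    if M: "hermitian_matrix M" "hermitian_matrix M'" for M M' :: "complex^'n^'n"
  proof -
    let ?S = "\<lambda>(x, y). (x, y + M *v x)"
    have h0: "hermitian_matrix (0 :: complex^'n^'n)"
      by (simp add: hermitian_matrix_def)
    have h: "hermitian_matrix (M' - M)"
      by (rule hermitian_diff[OF M(2,1)])
    have "i (?S ` lagr_graph 0, ?S ` lagr_graph (M' - M), ?S ` lagr_graph_inf) =
        i (lagr_graph 0, lagr_graph (M' - M), lagr_graph_inf)"
      by (intro is_duistermaat_indexD(3)[OF i] symplectic_shear M(1) lagr_graph_Lagrangian h0 h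
          lagr_graph_inf_Lagrangian)
    also have "\<dots> = n_minus (M' - M)"
      by (rule is_duistermaat_indexD(2)[OF i h])
    finally show ?thesis
      by (simp add: shear_graph shear_graph_inf)
  qed
  have "int (i (lagr_graph A, lagr_graph B, lagr_graph C))
      - int (i (lagr_graph A, lagr_graph B, lagr_graph_inf))
      + int (i (lagr_graph A, lagr_graph C, lagr_graph_inf))
      - int (i (lagr_graph B, lagr_graph C, lagr_graph_inf)) = 0"
    by (intro is_duistermaat_indexD(4)[OF i] lagr_graph_Lagrangian lagr_graph_inf_Lagrangian A B C)
  then show ?thesis
    by (simp add: shear A B C)
qed

text \<open>Extensionality settles the arguments that are not triples of Lagrangian planes; on the
  others invariance leads to graphs, where the values are forced.\<close>

lemma is_duistermaat_index_unique:
  fixes i j :: "((complex^'n) \<times> (complex^'n)) set \<times> ((complex^'n) \<times> (complex^'n)) set \<times>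
    ((complex^'n) \<times> (complex^'n)) set \<Rightarrow> nat"
  assumes i: "is_duistermaat_index i" and j: "is_duistermaat_index j"
  shows "i = j"
proof (rule PiE_ext)
  show "i \<in> (Lagrangian \<times> Lagrangian \<times> Lagrangian) \<rightarrow>\<^sub>E {0..CARD('n)}"
    "j \<in> (Lagrangian \<times> Lagrangian \<times> Lagrangian) \<rightarrow>\<^sub>E {0..CARD('n)}"
    by (rule is_duistermaat_indexD(1)[OF i], rule is_duistermaat_indexD(1)[OF j])
  fix p :: "((complex^'n) \<times> (complex^'n)) set \<times> ((complex^'n) \<times> (complex^'n)) set \<times>
    ((complex^'n) \<times> (complex^'n)) set"
  assume "p \<in> Lagrangian \<times> Lagrangian \<times> Lagrangian"
  then obtain L1 L2 L3 where p: "p = (L1, L2, L3)"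
      and L: "L1 \<in> Lagrangian" "L2 \<in> Lagrangian" "L3 \<in> Lagrangian"
    by blast
  obtain S A B C D where S: "symplectic S"
      and h: "hermitian_matrix A" "hermitian_matrix B" "hermitian_matrix C" "hermitian_matrix D"
      and im: "S ` L1 = lagr_graph A" "S ` L2 = lagr_graph B" "S ` L3 = lagr_graph C"
        "S ` L3 = lagr_graph D"
    by (rule four_Lagrangians_graphs[OF L L(3)])
  have "i p = i (lagr_graph A, lagr_graph B, lagr_graph C)"
    "j p = j (lagr_graph A, lagr_graph B, lagr_graph C)"
    using is_duistermaat_indexD(3)[OF i S L] is_duistermaat_indexD(3)[OF j S L]
    unfolding p im(1-3) by simp_all
  moreover have "int (i (lagr_graph A, lagr_graph B, lagr_graph C)) =
      int (j (lagr_graph A, lagr_graph B, lagr_graph C))"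
    by (simp add: is_duistermaat_index_graphs[OF i h(1-3)] is_duistermaat_index_graphs[OF j h(1-3)])
  ultimately show "i p = j p"
    by simp
qed

theorem theorem1p4:
  fixes A B C :: "complex^'n^'n"
  assumes "hermitian_matrix A" and "hermitian_matrix B" and "hermitian_matrix C"
  shows "int (duistermaat_index (lagr_graph A, lagr_graph B, lagr_graph C)) =
           int (n_minus (B - A)) - int (n_minus (C - A)) + int (n_minus (C - B))"
proof -
  \<comment> \<open>Existence and uniqueness together ensure that the definite description denotes a
    function with the defining properties.\<close>
  have "is_duistermaat_index (duistermaat_index :: ((complex^'n) \<times> (complex^'n)) set \<times> _ \<Rightarrow> nat)"
    unfolding duistermaat_index_def
    by (rule theI[where P = is_duistermaat_index, OF is_duistermaat_index_kashiwara_index])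
      (rule is_duistermaat_index_unique[OF _ is_duistermaat_index_kashiwara_index])
  then show ?thesis
    using assms by (rule is_duistermaat_index_graphs)
qed

end
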